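(* As $m \to \infty$, $A_{5,6}(m) = \Theta(m \log\log m)$, and for every fixed integer $d \geq 3$, $A_{5,2d+2}(m) = \Theta(m\,\alpha_d(m))$ (with implied constants that may depend on $d$).
   Context: All sequences are finite. A block is a contiguous, possibly empty, segment of a sequence whose letters are pairwise distinct. A sequence is on $m$ blocks if it is given as a concatenation of $m$ consecutive blocks. An alternation of length $s$ is a sequence $abab\cdots$ of length $s$ with $a \neq b$ distinct letters. A sequence avoids alternations of length $s$ if none of its (not necessarily contiguous) subsequences is an alternation of length $s$. For positive integers $s,k,m$, $A_{s,k}(m)$ denotes the maximum number of distinct letters in a sequence on $m$ blocks that avoids alternations of length $s$ and in which every letter that occurs does so at least $k$ times. The inverse Ackermann hierarchy: let $A_1(n)=2n$, and for $k\geq 2$ let $A_k(0)=1$ and $A_k(n)=A_{k-1}(A_k(n-1))$ for $n\geq 1$. Then $\alpha_k(x)=\min\{n : A_k(n)\geq x\}$ for $k \geq 1$. (These one-index functions $A_k(n)$ are unrelated to the two-index functions $A_{s,k}(m)$.) *)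

theory Defs
  imports Complex_Main "HOL-Library.Sublist" "HOL-Library.Landau_Symbols"
begin

definition is_block :: "'a list \<Rightarrow> bool" where
  "is_block b \<longleftrightarrow> distinct b"

definition on_blocks :: "nat \<Rightarrow> 'a list \<Rightarrow> bool" where
  "on_blocks m u \<longleftrightarrow> (\<exists>bs. length bs = m \<and> (\<forall>b\<in>set bs. is_block b) \<and> u = concat bs)"

definition is_alternation :: "nat \<Rightarrow> 'a list \<Rightarrow> bool" where
  "is_alternation s w \<longleftrightarrow>
     (\<exists>a b. a \<noteq> b \<and> w = map (\<lambda>i. if even i then a else b) [0..<s])"

definition avoids_alternations :: "nat \<Rightarrow> 'a list \<Rightarrow> bool" where
  "avoids_alternations s u \<longleftrightarrow> \<not> (\<exists>w. subseq w u \<and> is_alternation s w)"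

definition admissible :: "nat \<Rightarrow> nat \<Rightarrow> nat \<Rightarrow> 'a list \<Rightarrow> bool" where
  "admissible s k m u \<longleftrightarrow>
     on_blocks m u \<and> avoids_alternations s u \<and> (\<forall>x\<in>set u. k \<le> count_list u x)"

(* Sequences are finite, so natural numbers suffice as letters.  For parameters
   where the number of letters is unbounded, Max is an unspecified number. *)
definition max_letters :: "nat \<Rightarrow> nat \<Rightarrow> nat \<Rightarrow> nat" where
  "max_letters s k m = Max {card (set u) | u :: nat list. admissible s k m u}"

(* The hierarchy starts at index 1; index 0 is deliberately left unspecified. *)
fun ack_hier :: "nat \<Rightarrow> nat \<Rightarrow> nat" where
  "ack_hier (Suc 0) n = 2 * n"
| "ack_hier (Suc (Suc k)) 0 = 1"
| "ack_hier (Suc (Suc k)) (Suc n) = ack_hier (Suc k) (ack_hier (Suc (Suc k)) n)"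

definition inv_ack :: "nat \<Rightarrow> nat \<Rightarrow> nat" where
  "inv_ack k x = (LEAST n. ack_hier k n \<ge> x)"

end

theory Submission
  imports Defs "HOL-Library.Product_Lexorder" "HOL-Library.Nat_Bijection"
begin

text \<open>
  Both bounds follow one recursion in the number \<open>k\<close> of occurrences, which goes from \<open>k\<close> to
  \<open>k + 2\<close> and starts at \<open>k = 4\<close>, where the number of letters is quadratic in \<open>m\<close>.

  Upper bound: two letters that both occur in each of four consecutive zones form an alternation of
  length 5. Hence the letters inject into any family of triples of cuts that separates every
  \<open>k\<close>-set of blocks into four nonempty parts. Let \<open>T\<^sub>k(m)\<close> be the least size of such a
  family, and split the \<open>m\<close> blocks into groups of size \<open>t\<close>. A \<open>(k+2)\<close>-set lies in one group, or is cut
  by one of \<open>3m\<close> triples made of a block and the ends of its group, or meets at least \<open>k\<close> groups. So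
  \<open>T\<^bsub>k+2\<^esub>(m) \<le> (m/t) T\<^bsub>k+2\<^esub>(t) + T\<^sub>k(m/t) + 3m\<close>.

  Lower bound: in a sequence with \<open>k\<close> occurrences per letter, replace every block of first
  and last occurrences by a copy of a sequence with \<open>k + 2\<close> occurrences per letter. The
  first and the last occurrence of an old letter are doubled, and the two halves are put on both sides
  of a gap between two blocks of the copy. They stay adjacent, so the copy does not see more
  than one old occurrence.
\<close>

section \<open>Families of cutting triples\<close>

text \<open>Ackermann-type functions come out of the choice of the group size. Suppose that
  \<open>k\<close> occurrences allow the bound \<open>C * m * n\<close> for all
  \<open>m \<le> f n\<close>. If groups have size \<open>t = g n\<close> and there are at most
  \<open>f t\<close> of them, the cost between groups is of order \<open>(m / t) * t = m\<close>.
  One more unit of \<open>n\<close> pays for this, and \<open>m\<close> may reach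
  \<open>g n * f (g n)\<close>. Starting from \<open>f n = n\<close> this is repeated squaring,
  hence \<open>2 ^ 2 ^ n\<close> and a double logarithm for six occurrences; each further level
  iterates the level before. The hierarchy has \<open>2 ^ n\<close> at level 2 where the recursion
  has \<open>2 ^ 2 ^ n\<close>, so that level is treated apart. From level 3 on, both agree up to a
  constant factor in the argument, because the additional growth costs a bounded number of steps of
  the next function. The lower bound meets the same recursion through a matching condition: a core
  with up to \<open>t\<close> first and \<open>t\<close> last occurrences needs a copy with
  \<open>t\<close> slots. One slot serves one occurrence of each kind, since the gaps before and
  behind its core are different. With \<open>N\<close> cores the result has \<open>N * t\<close>
  slots.\<close>

definition cuts :: "nat \<times> nat \<times> nat \<Rightarrow> nat set \<Rightarrow> bool" where
  "cuts = (\<lambda>(p1, p2, p3) A. (\<exists>x\<in>A. x < p1) \<and> (\<exists>x\<in>A. p1 \<le> x \<and> x < p2) \<and>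
    (\<exists>x\<in>A. p2 \<le> x \<and> x < p3) \<and> (\<exists>x\<in>A. p3 \<le> x))"

definition cuttable :: "nat \<Rightarrow> nat \<Rightarrow> nat \<Rightarrow> bool" where
  "cuttable k m Q \<longleftrightarrow> (\<exists>F. finite F \<and> card F \<le> Q \<and>
    (\<forall>A \<subseteq> {..<m}. k \<le> card A \<longrightarrow> (\<exists>z\<in>F. cuts z A)))"

lemma cuts_iff: "cuts (p1, p2, p3) A \<longleftrightarrow> (\<exists>x\<in>A. x < p1) \<and> (\<exists>x\<in>A. p1 \<le> x \<and> x < p2) \<and>
    (\<exists>x\<in>A. p2 \<le> x \<and> x < p3) \<and> (\<exists>x\<in>A. p3 \<le> x)"
  by (simp add: cuts_def)

lemma cutsI:
  assumes "a \<in> A" "b \<in> A" "c \<in> A" "d \<in> A" 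
    "a < p1" "p1 \<le> b" "b < p2" "p2 \<le> c" "c < p3" "p3 \<le> d"
  shows "cuts (p1, p2, p3) A"
  unfolding cuts_iff using assms by blast

lemma cuttable_mono: "cuttable k m Q \<Longrightarrow> Q \<le> Q' \<Longrightarrow> cuttable k m Q'"
  unfolding cuttable_def by (meson le_trans)

lemma ex_smaller:
  fixes A :: "nat set"
  assumes "Suc n \<le> card A"
  shows "\<exists>a\<in>A. n \<le> card {x \<in> A. a < x}"
proof -
  have fin: "finite A" and ne: "A \<noteq> {}" using assms card.infinite by fastforce+
  have "{x \<in> A. Min A < x} = A - {Min A}" using fin by (auto simp: order.strict_iff_order)
  then have "card {x \<in> A. Min A < x} = card A - 1" using fin ne by simp
  then show ?thesis using assms fin ne by (intro bexI[of _ "Min A"]) auto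
qed

lemma ex_less_2:
  fixes A :: "nat set"
  assumes "2 \<le> card A" obtains a b where "a \<in> A" "b \<in> A" "a < b"
proof -
  obtain a where a: "a \<in> A" "1 \<le> card {x \<in> A. a < x}" using ex_smaller[of 1 A] assms by auto
  then obtain b where "b \<in> {x \<in> A. a < x}" using ex_smaller[of 0 "{x \<in> A. a < x}"] by auto
  with a that show ?thesis by auto
qed

lemma ex_less_3:
  fixes A :: "nat set"
  assumes "3 \<le> card A" obtains a b c where "a \<in> A" "b \<in> A" "c \<in> A" "a < b" "b < c"
proof -
  obtain a where a: "a \<in> A" "2 \<le> card {x \<in> A. a < x}" using ex_smaller[of 2 A] assms by auto
  obtain b c where "b \<in> {x \<in> A. a < x}" "c \<in> {x \<in> A. a < x}" "b < c" by (rule ex_less_2[OF a(2)])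
  with a that show ?thesis by auto
qed

lemma ex_less_4:
  fixes A :: "nat set"
  assumes "4 \<le> card A" obtains a b c d where "a \<in> A" "b \<in> A" "c \<in> A" "d \<in> A" "a < b" "b < c" "c < d"
proof -
  obtain a where a: "a \<in> A" "3 \<le> card {x \<in> A. a < x}" using ex_smaller[of 3 A] assms by auto
  obtain b c d where "b \<in> {x \<in> A. a < x}" "c \<in> {x \<in> A. a < x}" "d \<in> {x \<in> A. a < x}"
    "b < c" "c < d" by (rule ex_less_3[OF a(2)])
  with a that show ?thesis by auto
qed

text \<open>Of four elements the second and the fourth determine suitable cuts: \<open>b\<close> and
  \<open>b + 1\<close> isolate the second one, and the third one lies between \<open>b + 1\<close>
  and \<open>d\<close>.\<close>

lemma cuttable_4: "cuttable 4 m (m * m)"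
  unfolding cuttable_def
proof (intro exI conjI allI impI)
  let ?F = "(\<lambda>(p, q). (p, p + 1, q)) ` ({..<m} \<times> {..<m})"
  show "finite ?F" by simp
  show "card ?F \<le> m * m" using card_image_le[of "{..<m} \<times> {..<m}" "\<lambda>(p, q). (p, p + 1, q)"] by simp
  fix A assume A: "A \<subseteq> {..<m}" "4 \<le> card A"
  obtain a b c d where
    abcd: "a \<in> A" "b \<in> A" "c \<in> A" "d \<in> A" "a < b" "b < c" "c < d" by (rule ex_less_4[OF A(2)])
  then have "(b, d) \<in> {..<m} \<times> {..<m}" using A by auto
  then have "(b, b + 1, d) \<in> ?F" by (rule rev_image_eqI) simp
  moreover have "cuts (b, b + 1, d) A" using abcd by (intro cutsI[of a A b c d]) auto
  ultimately show "\<exists>z\<in>?F. cuts z A" by (rule bexI[rotated])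
qed

abbreviation shift3 :: "nat \<Rightarrow> nat \<times> nat \<times> nat \<Rightarrow> nat \<times> nat \<times> nat" where
  "shift3 s \<equiv> map_prod ((+) s) (map_prod ((+) s) ((+) s))"

abbreviation scale3 :: "nat \<Rightarrow> nat \<times> nat \<times> nat \<Rightarrow> nat \<times> nat \<times> nat" where
  "scale3 s \<equiv> map_prod ((*) s) (map_prod ((*) s) ((*) s))"

lemma cuts_shift:
  assumes "cuts z ((\<lambda>x. x - s) ` A)" "\<forall>x\<in>A. s \<le> x"
  shows "cuts (shift3 s z) A"
proof -
  obtain p1 p2 p3 where z: "z = (p1, p2, p3)" by (cases z)
  from assms(1)[unfolded z cuts_iff bex_simps(7)] obtain a b c d where x: "a \<in> A" "b \<in> A" "c \<in> A" "d \<in> A"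
    "a - s < p1" "p1 \<le> b - s" "b - s < p2" "p2 \<le> c - s" "c - s < p3" "p3 \<le> d - s"
    by blast
  with assms(2) have "s \<le> a" "s \<le> b" "s \<le> c" "s \<le> d" by auto
  with x have "a < s + p1" "s + p1 \<le> b" "b < s + p2" "s + p2 \<le> c" "c < s + p3" "s + p3 \<le> d"
    by linarith+
  with x show ?thesis unfolding z map_prod_simp by (intro cutsI)
qed

lemma cuts_scale:
  assumes "cuts z ((\<lambda>x. x div t) ` A)" "1 \<le> t"
  shows "cuts (scale3 t z) A"
proof -
  have lt: "x < t * p \<longleftrightarrow> x div t < p" for x p
    using assms(2) by (simp add: div_less_iff_less_mult mult.commute)
  then have le: "t * p \<le> x \<longleftrightarrow> p \<le> x div t" for x p by (meson not_less)
  obtain p1 p2 p3 where z: "z = (p1, p2, p3)" by (cases z)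
  from assms(1)[unfolded z cuts_iff bex_simps(7)] show ?thesis 
    unfolding z map_prod_simp cuts_iff lt le .
qed

text \<open>In \<open>cuttable_step\<close>, \<open>g0\<close> and \<open>g1\<close> are the first
  and the last group met, and the hypothesis is what remains when no triple attached to a single
  block cuts the set. The excess 2 is the reason why a level costs two occurrences.\<close>

lemma card_groups:
  assumes fin: "finite A" and g: "g0 \<noteq> g1"
    and "\<And>g. card {x \<in> A. f x = g} \<le> (if g = g0 \<or> g = g1 then 2 else 1)"
  shows "card A \<le> card (f ` A) + 2"
proof -
  have "card A = (\<Sum>g\<in>f ` A. card {x \<in> A. f x = g})"
    using sum.image_gen[OF fin, of "\<lambda>_. 1::nat" f] by simp
  also have "\<dots> \<le> (\<Sum>g\<in>f ` A. 1 + ((if g = g0 then 1 else 0) + (if g = g1 then 1 else 0)))"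
  proof (rule sum_mono)
    fix g show "card {x \<in> A. f x = g} \<le> 1 + ((if g = g0 then 1 else 0) + (if g = g1 then 1 else 0))"
      using assms(3)[of g] g by (auto split: if_splits)
  qed
  also have "\<dots> \<le> card (f ` A) + 2"
    by (simp only: sum.distrib) (simp add: fin)
  finally show ?thesis .
qed

text \<open>The bound inside a group is linear with one \<open>C\<close> for all sizes up to
  \<open>t\<close>, because the last group may be incomplete; the costs of the groups then add up to
  \<open>C * m\<close>. For positive \<open>m\<close> the number of groups is
  \<open>(m - 1) div t + 1\<close>.\<close>

lemma cuttable_step:
  assumes t: "1 \<le> t"
    and within: "\<And>m'. m' \<le> t \<Longrightarrow> cuttable (k + 2) m' (C * m')"
    and between: "cuttable k ((m - 1) div t + 1) Q"
  shows "cuttable (k + 2) m (C * m + 3 * m + Q)"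
proof -
  obtain F where F: "\<And>m'. m' \<le> t \<Longrightarrow> finite (F m') \<and> card (F m') \<le> C * m' \<and>
    (\<forall>A \<subseteq> {..<m'}. k + 2 \<le> card A \<longrightarrow> (\<exists>z\<in>F m'. cuts z A))"
    using within unfolding cuttable_def by metis
  obtain H where H: "finite H" "card H \<le> Q"
    "\<And>A. A \<subseteq> {..<(m - 1) div t + 1} \<Longrightarrow> k \<le> card A \<Longrightarrow> (\<exists>z\<in>H. cuts z A)"
    using between unfolding cuttable_def by metis
  define s where "s p = p div t * t" for p
  define F1 where "F1 = (\<Union>g<m div t. shift3 (g * t) ` F t)"
  define F2 where "F2 = shift3 (s m) ` F (m mod t)"
  \<comment> \<open>\<open>s p\<close> is the start of the group of \<open>p\<close>.
    \<open>F3\<close> and \<open>F4\<close> serve three elements in one group, \<open>p\<close>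
    being the middle one, with a fourth element behind or in front of the group. \<open>F5\<close>
    serves two elements, \<open>p\<close> being the later one, with one element on each side of the
    group.\<close>
  define F3 where "F3 = (\<lambda>p. (p, p + 1, s p + t)) ` {..<m}"
  define F4 where "F4 = (\<lambda>p. (s p, p, p + 1)) ` {..<m}"
  define F5 where "F5 = (\<lambda>p. (s p, p, s p + t)) ` {..<m}"
  define F6 where "F6 = scale3 t ` H"
  have mod: "m mod t < t" using t by simp
  have fin: "finite F1" "finite F2" "finite F3" "finite F4" "finite F5" "finite F6"
    using F[of t] F[of "m mod t"] mod H by (auto simp: F1_def F2_def F3_def F4_def F5_def F6_def)
  have "card F1 \<le> (\<Sum>g<m div t. C * t)"
    unfolding F1_def using F[of t] 
    by (intro order_trans[OF card_UN_le] sum_mono order_trans[OF card_image_le]) auto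
  moreover have "card F2 \<le> C * (m mod t)"
    unfolding F2_def using F[of "m mod t"] mod by (intro order_trans[OF card_image_le]) auto
  moreover have "(\<Sum>g<m div t. C * t) + C * (m mod t) = C * m"
  proof -
    have "(\<Sum>g<m div t. C * t) + C * (m mod t) = C * (m div t * t + m mod t)"
      by (simp only: distrib_left) simp
    then show ?thesis by simp
  qed
  ultimately have "card F1 + card F2 \<le> C * m" by linarith
  moreover have "card F3 \<le> m" "card F4 \<le> m" "card F5 \<le> m"
    unfolding F3_def F4_def F5_def by (rule order_trans[OF card_image_le]; simp)+
  moreover have "card F6 \<le> Q" unfolding F6_def using H by (intro order_trans[OF card_image_le]) auto
  moreover have "card (F1 \<union> F2 \<union> F3 \<union> F4 \<union> F5 \<union> F6) \<le> card F1 + card F2 + card F3 + card F4 + card F5 + card F6"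
    by (intro order_trans[OF card_Un_le] add_mono order_refl)
  ultimately have card: "card (F1 \<union> F2 \<union> F3 \<union> F4 \<union> F5 \<union> F6) \<le> C * m + 3 * m + Q" by linarith
  have "\<exists>z\<in>F1 \<union> F2 \<union> F3 \<union> F4 \<union> F5 \<union> F6. cuts z A" if A: "A \<subseteq> {..<m}" "k + 2 \<le> card A" for A
  proof -
    have finA: "finite A" using A finite_subset by auto
    have s_le: "s x \<le> x" for x by (simp add: s_def)
    have s_less: "x < s x + t" for x
      using t by (metis add.commute add_less_cancel_left div_mult_mod_eq mod_less_divisor not_one_le_zero
          not_gr_zero s_def)
    have before: "x < s y" if "x div t < y div t" for x y
      using that t by (simp add: s_def flip: div_less_iff_less_mult)
    have after: "s x + t \<le> y" if "x div t < y div t" for x y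
    proof -
      have "(x div t + 1) * t \<le> y div t * t" using that by (intro mult_le_mono1) auto
      also have "\<dots> \<le> y" by simp
      finally show ?thesis by (simp add: s_def)
    qed
    have s_eq: "s x = s y" if "x div t = y div t" for x y using that by (simp add: s_def)
    consider (one) g where "\<forall>x\<in>A. x div t = g"
      | (right) g y where "3 \<le> card {x \<in> A. x div t = g}" "y \<in> A" "g < y div t"
      | (left) g y where "3 \<le> card {x \<in> A. x div t = g}" "y \<in> A" "y div t < g"
      | (mid) g y y' where "2 \<le> card {x \<in> A. x div t = g}" "y \<in> A" "y div t < g" "y' \<in> A" "g < y' div t"
      | (spread) "k \<le> card ((\<lambda>x. x div t) ` A)"
    proof -
      show thesis
      proof (cases "\<exists>g. \<forall>x\<in>A. x div t = g")
        case True then show ?thesis using one by blast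
      next
        case False
        define I where "I = (\<lambda>x. x div t) ` A"
        have I: "finite I" "I \<noteq> {}" using finA False by (auto simp: I_def)
        define g0 g1 where "g0 = Min I" and "g1 = Max I"
        have g: "g0 \<in> I" "g1 \<in> I" "\<And>g. g \<in> I \<Longrightarrow> g0 \<le> g \<and> g \<le> g1"
          using I by (auto simp: g0_def g1_def)
        have "g0 \<noteq> g1" using False g(3) unfolding I_def by (metis imageI le_antisym)
        obtain y0 y1 where y: "y0 \<in> A" "y0 div t = g0" "y1 \<in> A" "y1 div t = g1" using g by (auto simp: I_def)
        \<comment> \<open>Either all groups are small enough for \<open>card_groups\<close>, or some
          group is crowded. As elements lie outside it, three elements suffice in an end group and
          two in an inner group.\<close>
        show ?thesis
        proof (cases "\<forall>g. card {x \<in> A. x div t = g} \<le> (if g = g0 \<or> g = g1 then 2 else 1)")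
          case True
          from card_groups[OF finA \<open>g0 \<noteq> g1\<close>, of "\<lambda>x. x div t"] True A(2) spread show ?thesis by fastforce
        next
          case False
          then obtain gg where gg: "\<not> card {x \<in> A. x div t = gg} \<le> (if gg = g0 \<or> gg = g1 then 2 else 1)" by blast
          then have "{x \<in> A. x div t = gg} \<noteq> {}" by (metis card.empty le0)
          then have "gg \<in> I" by (auto simp: I_def)
          then have "g0 \<le> gg" "gg \<le> g1" using g by auto
          then consider "gg = g0" | "gg = g1" | "g0 < gg" "gg < g1" by linarith
          then show ?thesis
          proof cases
            case 1
            then show ?thesis using right[of gg y1] gg y \<open>gg \<le> g1\<close> \<open>g0 \<noteq> g1\<close> by auto
          next
            case 2
            then show ?thesis using left[of gg y0] gg y \<open>g0 \<le> gg\<close> \<open>g0 \<noteq> g1\<close> by auto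
          next
            case 3
            then show ?thesis using mid[of gg y0 y1] gg y by auto
          qed
        qed
      qed
    qed
    then show ?thesis
    proof cases
      case one
      then have lo: "\<forall>x\<in>A. g * t \<le> x" using t by (auto simp: less_eq_div_iff_mult_less_eq[symmetric])
      let ?B = "(\<lambda>x. x - g * t) ` A"
      have cB: "k + 2 \<le> card ?B"
        using A(2) by (subst card_image) (use lo in \<open>auto simp: inj_on_def; metis add_left_cancel le_add_diff_inverse\<close>)
      have xg: "x - g * t = x mod t" if "x \<in> A" for x using one that by (metis minus_div_mult_eq_mod)
      obtain a where a: "a \<in> A" using A(2) by (cases "A = {}") auto
      have "g \<le> m div t" using one a A(1) by (metis div_le_mono lessThan_iff less_imp_le subsetD)
      show ?thesis
      proof (cases "g < m div t")
        case True
        have "?B \<subseteq> {..<t}" using xg t by auto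
        with F[of t] cB obtain z where "z \<in> F t" "cuts z ?B" by auto
        with cuts_shift[OF _ lo] have "cuts (shift3 (g * t) z) A" "shift3 (g * t) z \<in> F1"
          using True by (auto simp: F1_def)
        then show ?thesis by blast
      next
        case False
        then have g: "g = m div t" using \<open>g \<le> m div t\<close> by simp
        have "x - g * t < m mod t" if "x \<in> A" for x
        proof -
          have "x < m" "g * t \<le> x" "m = g * t + m mod t" using that A(1) lo g by auto
          then show ?thesis by linarith
        qed
        then have "?B \<subseteq> {..<m mod t}" by auto
        with F[of "m mod t"] mod cB obtain z where "z \<in> F (m mod t)" "cuts z ?B" by auto
        with cuts_shift[OF _ lo] have "cuts (shift3 (g * t) z) A" "shift3 (g * t) z \<in> F2"
          by (auto simp: F2_def g s_def)
        then show ?thesis by blast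
      qed
    next
      case right
      obtain a b c where "a \<in> {x \<in> A. x div t = g}" "b \<in> {x \<in> A. x div t = g}"
        "c \<in> {x \<in> A. x div t = g}" "a < b" "b < c" by (rule ex_less_3[OF right(1)])
      then have abc: "a \<in> A" "b \<in> A" "c \<in> A" "a < b" "b < c" "b div t = g" "c div t = g" by auto
      have "c < s b + t" using s_less[of c] s_eq[of b c] abc by simp
      moreover have "s b + t \<le> y" using after right abc by simp
      ultimately have "cuts (b, b + 1, s b + t) A" using abc right by (intro cutsI[of a A b c y]) auto
      moreover have "(b, b + 1, s b + t) \<in> F3" using abc A(1) by (auto simp: F3_def)
      ultimately show ?thesis by blast
    next
      case left
      obtain a b c where "a \<in> {x \<in> A. x div t = g}" "b \<in> {x \<in> A. x div t = g}"
        "c \<in> {x \<in> A. x div t = g}" "a < b" "b < c" by (rule ex_less_3[OF left(1)])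
      then have abc: "a \<in> A" "b \<in> A" "c \<in> A" "a < b" "b < c" "a div t = g" "b div t = g" by auto
      have "s b \<le> a" using s_le[of a] s_eq[of a b] abc by simp
      moreover have "y < s b" using before left abc by simp
      ultimately have "cuts (s b, b, b + 1) A" using abc left by (intro cutsI[of y A a b c]) auto
      moreover have "(s b, b, b + 1) \<in> F4" using abc A(1) by (auto simp: F4_def)
      ultimately show ?thesis by blast
    next
      case mid
      obtain a b where "a \<in> {x \<in> A. x div t = g}" "b \<in> {x \<in> A. x div t = g}" "a < b"
        by (rule ex_less_2[OF mid(1)])
      then have ab: "a \<in> A" "b \<in> A" "a < b" "a div t = g" "b div t = g" by auto
      have "s b \<le> a" "b < s b + t" using s_le[of a] s_less[of b] s_eq[of a b] ab by simp_all
      moreover have "y < s b" "s b + t \<le> y'" using before after mid ab by simp_all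
      ultimately have "cuts (s b, b, s b + t) A" using ab mid by (intro cutsI[of y A a b y']) auto
      moreover have "(s b, b, s b + t) \<in> F5" using ab A(1) by (auto simp: F5_def)
      ultimately show ?thesis by blast
    next
      case spread
      have "x div t < (m - 1) div t + 1" if "x \<in> A" for x
      proof -
        have "x \<le> m - 1" using A(1) that by (auto dest!: subsetD)
        then have "x div t \<le> (m - 1) div t" by (rule div_le_mono)
        then show ?thesis by simp
      qed
      then have "(\<lambda>x. x div t) ` A \<subseteq> {..<(m - 1) div t + 1}" by auto
      from H(3)[OF this spread] obtain z where "z \<in> H" "cuts z ((\<lambda>x. x div t) ` A)" by blast
      with cuts_scale[OF _ t] have "cuts (scale3 t z) A" "scale3 t z \<in> F6" by (auto simp: F6_def)
      then show ?thesis by blast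
    qed
  qed
  then show ?thesis unfolding cuttable_def using fin card by (intro exI[of _ "F1 \<union> F2 \<union> F3 \<union> F4 \<union> F5 \<union> F6"]) auto
qed


section \<open>Iterating the recursion for cutting families\<close>

text \<open>\<open>n\<close> is the cost per block and \<open>f n\<close> a size that can be handled
  at this cost, so the inverse of \<open>f\<close> becomes the factor in the upper bound. In this
  form the recursion composes functions, and no inverse has to be estimated.\<close>

definition cut_bound :: "nat \<Rightarrow> (nat \<Rightarrow> nat) \<Rightarrow> nat \<Rightarrow> bool" where
  "cut_bound k f C \<longleftrightarrow> (\<forall>n m. m \<le> f n \<longrightarrow> cuttable k m (C * m * n))"

lemma cuttable_trivial:
  assumes "m < k" shows "cuttable k m Q"
proof -
  have "\<not> k \<le> card A" if "A \<subseteq> {..<m}" for A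
    using card_mono[OF _ that] assms by simp
  then show ?thesis unfolding cuttable_def by (intro exI[of _ "{}"]) auto
qed

lemma cut_bound_4: "cut_bound 4 (\<lambda>n. n) 1"
  unfolding cut_bound_def using cuttable_mono[OF cuttable_4] by simp

text \<open>With groups of size \<open>t = g n\<close>, the inside costs \<open>n\<close> units per
  block by induction. The at most \<open>f t\<close> groups cost \<open>C * t\<close> each; rounding
  their number up at most doubles it when \<open>t < m\<close>, so this is at most
  \<open>2 * C * m\<close>. Together with \<open>3 * m\<close> this gives the constant
  \<open>2 * C + 3\<close>.\<close>

lemma cut_bound_step:
  assumes f: "cut_bound k f C" and g0: "g 0 \<le> k + 1" and gpos: "\<And>n. 1 \<le> g n"
    and gSuc: "\<And>n. g (Suc n) \<le> g n * f (g n)"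
  shows "cut_bound (k + 2) g (2 * C + 3)"
  unfolding cut_bound_def
proof (rule allI)
  fix n
  show "\<forall>m. m \<le> g n \<longrightarrow> cuttable (k + 2) m ((2 * C + 3) * m * n)" 
  proof (induction n)
    \<comment> \<open>The bound is 0 here, so there must be too few blocks for any set of size
      \<open>k + 2\<close>.\<close>
    case 0
    then show ?case using g0 cuttable_trivial by auto
  next
    case (Suc n)
    let ?D = "2 * C + 3"
    show ?case
    proof (intro allI impI)
      fix m assume m: "m \<le> g (Suc n)"
      define t where "t = g n"
      have t: "1 \<le> t" using gpos by (simp add: t_def)
      show "cuttable (k + 2) m (?D * m * Suc n)"
      proof (cases "m \<le> t")
        case True
        with Suc show ?thesis by (auto simp: t_def elim!: cuttable_mono)
      next
        case False
        have "m - 1 < t * f t" using m gSuc[of n] False t by (simp add: t_def)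
        then have "(m - 1) div t < f t" using t by (simp add: div_less_iff_less_mult mult.commute)
        then have "cuttable k ((m - 1) div t + 1) (C * ((m - 1) div t + 1) * t)"
          using f[unfolded cut_bound_def, rule_format, of "(m - 1) div t + 1" t] by simp
        moreover have "cuttable (k + 2) m' (?D * n * m')" if "m' \<le> t" for m'
          using Suc that by (simp add: t_def mult_ac)
        ultimately have "cuttable (k + 2) m (?D * n * m + 3 * m + C * ((m - 1) div t + 1) * t)"
          using t by (intro cuttable_step) auto
        moreover have "?D * n * m + 3 * m + C * ((m - 1) div t + 1) * t \<le> ?D * m * Suc n"
        proof -
          have "(m - 1) div t * t \<le> m - 1" by simp
          then have "((m - 1) div t + 1) * t \<le> 2 * m" using False by (simp only: distrib_right)
          then have "C * (((m - 1) div t + 1) * t) \<le> C * (2 * m)" by (rule mult_le_mono2)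
          then show ?thesis by (simp add: algebra_simps)
        qed
        ultimately show ?thesis by (rule cuttable_mono)
      qed
    qed
  qed
qed

lemma cut_bound_6: "cut_bound 6 (\<lambda>n. 2 ^ 2 ^ n) 5"
proof -
  have "cut_bound (4 + 2) (\<lambda>n. 2 ^ 2 ^ n) (2 * 1 + 3)"
    by (rule cut_bound_step[OF cut_bound_4]) (auto simp: mult_2 power_add)
  then show ?thesis by simp
qed

lemma ack_hier_2: "ack_hier 2 n = 2 ^ n"
  by (induction n) (auto simp: numeral_2_eq_2)

lemma ack_hier_ge_1: "2 \<le> d \<Longrightarrow> 1 \<le> ack_hier d n"
proof (induction d n rule: ack_hier.induct)
  case (3 k n)
  then show ?case by (cases k) auto
qed auto

text \<open>The start gives away one exponential to fall into step with the hierarchy. Afterwards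
  \<open>ack_hier d (ack_hier (Suc d) n)\<close> alone is at most the product allowed by
  \<open>cut_bound_step\<close>.\<close>

lemma cut_bound_ack: "2 \<le> d \<Longrightarrow> \<exists>C. cut_bound (2 * d + 2) (ack_hier d) C"
proof (induction d rule: dec_induct)
  case base
  have "(2::nat) ^ n \<le> 2 ^ 2 ^ n" for n by (rule power_increasing) auto
  with cut_bound_6 have "cut_bound 6 (ack_hier 2) 5"
    unfolding cut_bound_def ack_hier_2 by (meson order_trans)
  then show ?case by auto
next
  case (step d)
  then obtain C where C: "cut_bound (2 * d + 2) (ack_hier d) C" by blast
  from step obtain d' where d: "d = Suc d'" by (cases d) auto
  have pos: "1 \<le> ack_hier (Suc d) n" for n using step by (intro ack_hier_ge_1) auto
  have "cut_bound (2 * d + 2 + 2) (ack_hier (Suc d)) (2 * C + 3)"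
  proof (rule cut_bound_step[OF C])
    fix n show "ack_hier (Suc d) (Suc n) \<le> ack_hier (Suc d) n * ack_hier d (ack_hier (Suc d) n)"
      using pos[of n] by (simp add: d)
  qed (use pos d in auto)
  then show ?case by (auto simp: algebra_simps)
qed

section \<open>From cutting families to bounds on the number of letters\<close>

lemma both_letters_subseq:
  assumes "x \<noteq> y" "x \<in> set u" "y \<in> set u"
  shows "subseq [x, y] u \<or> subseq [y, x] u"
  using assms
proof (induction u)
  case (Cons a u)
  then consider "a = x" "y \<in> set u" | "a = y" "x \<in> set u" | "x \<in> set u" "y \<in> set u" by auto
  then show ?case
    by cases (use Cons in \<open>auto simp: subseq_singleton_left\<close>)
qed simp

text \<open>Name the letters \<open>a\<close>, \<open>b\<close> in an order in which the first zone
  contains them. It then supplies two terms of the alternation, and each other zone supplies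
  one.\<close>

lemma four_zones_alternation:
  assumes "x \<noteq> y" and u: "u = u1 @ u2 @ u3 @ u4"
    and "\<And>v. v \<in> {u1, u2, u3, u4} \<Longrightarrow> x \<in> set v \<and> y \<in> set v"
  shows "\<not> avoids_alternations 5 u"
proof -
  obtain a b where ab: "subseq [a, b] u1" "a \<noteq> b" "{a, b} = {x, y}"
    using both_letters_subseq[of x y u1] assms by auto
  have "a \<in> set v \<and> b \<in> set v" if "v \<in> {u1, u2, u3, u4}" for v
    using assms(3)[OF that] ab(3) by (auto simp: doubleton_eq_iff)
  then have "subseq [a] u2" "subseq [b] u3" "subseq [a] u4" by (simp_all add: subseq_singleton_left)
  with ab(1) have "subseq ([a, b] @ [a] @ [b] @ [a]) u"
    unfolding u by (intro list_emb_append_mono)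
  moreover have "is_alternation 5 ([a, b] @ [a] @ [b] @ [a])"
    unfolding is_alternation_def using ab(2)
    by (intro exI[of _ a] exI[of _ b]) (simp add: upt_rec)
  ultimately show ?thesis unfolding avoids_alternations_def by blast
qed

lemma admissible_card_le:
  assumes adm: "admissible 5 k m u" and cut: "cuttable k m Q"
  shows "card (set u) \<le> Q"
proof -
  obtain bs where bs: "length bs = m" "\<And>b. b \<in> set bs \<Longrightarrow> distinct b" "u = concat bs"
    using adm unfolding admissible_def on_blocks_def is_block_def by blast
  define A where "A x = {j. j < m \<and> x \<in> set (bs ! j)}" for x
  \<comment> \<open>Letters of a block are distinct, so occurrences can be counted by
    blocks.\<close>
  have count: "count_list (concat cs) x = card {j. j < length cs \<and> x \<in> set (cs ! j)}"
    if "\<And>b. b \<in> set cs \<Longrightarrow> distinct b" for cs x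
    using that
  proof (induction cs rule: rev_induct)
    case (snoc b cs)
    have "{j. j < length (cs @ [b]) \<and> x \<in> set ((cs @ [b]) ! j)} =
      {j. j < length cs \<and> x \<in> set (cs ! j)} \<union> (if x \<in> set b then {length cs} else {})"
      by (auto simp: nth_append less_Suc_eq split: if_splits)
    moreover have "count_list b x = (if x \<in> set b then 1 else 0)"
      using snoc.prems[of b] by (induction b) (auto simp: count_list_0_iff)
    ultimately show ?case using snoc by (auto simp: card_insert_if)
  qed simp
  have "count_list u x = card (A x)" for x
    using count[OF bs(2)] by (simp add: bs(3) A_def flip: bs(1))
  then have A: "A x \<subseteq> {..<m}" "k \<le> card (A x)" if "x \<in> set u" for x
    using adm that by (auto simp: admissible_def A_def)
  obtain F where F: "finite F" "card F \<le> Q" "\<And>B. B \<subseteq> {..<m} \<Longrightarrow> k \<le> card B \<Longrightarrow> \<exists>z\<in>F. cuts z B"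
    using cut unfolding cuttable_def by metis
  have "\<exists>h. \<forall>x\<in>set u. h x \<in> F \<and> cuts (h x) (A x)"
    using F(3)[OF A] by (intro bchoice) blast
  then obtain h where h: "\<And>x. x \<in> set u \<Longrightarrow> h x \<in> F \<and> cuts (h x) (A x)" by blast
  have "inj_on h (set u)"
  proof (rule inj_onI, rule ccontr)
    fix x y assume xy: "x \<in> set u" "y \<in> set u" "h x = h y" "x \<noteq> y"
    obtain p1 p2 p3 where z: "h x = (p1, p2, p3)" by (cases "h x")
    let ?u1 = "concat (take p1 bs)" and ?u2 = "concat (take (p2 - p1) (drop p1 bs))"
      and ?u3 = "concat (take (p3 - p2) (drop p2 bs))" and ?u4 = "concat (drop p3 bs)"
    have zones: "w \<in> set ?u1 \<and> w \<in> set ?u2 \<and> w \<in> set ?u3 \<and> w \<in> set ?u4 \<and> p1 \<le> p2 \<and> p2 \<le> p3"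
      if w: "w \<in> set u" "h w = (p1, p2, p3)" for w
    proof -
      have "cuts (p1, p2, p3) (A w)" using h w by metis
      then obtain a b c d where "a \<in> A w" "b \<in> A w" "c \<in> A w" "d \<in> A w"
        "a < p1" "p1 \<le> b" "b < p2" "p2 \<le> c" "c < p3" "p3 \<le> d" unfolding cuts_iff by blast
      note abcd = this[unfolded A_def mem_Collect_eq]
      have "bs ! a \<in> set (take p1 bs)" using abcd bs(1) by (auto simp: in_set_conv_nth intro!: exI[of _ a])
      moreover have "bs ! b \<in> set (take (p2 - p1) (drop p1 bs))"
        using abcd bs(1) by (auto simp: in_set_conv_nth intro!: exI[of _ "b - p1"])
      moreover have "bs ! c \<in> set (take (p3 - p2) (drop p2 bs))"
        using abcd bs(1) by (auto simp: in_set_conv_nth intro!: exI[of _ "c - p2"])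
      moreover have "bs ! d \<in> set (drop p3 bs)"
        using abcd bs(1) by (auto simp: in_set_conv_nth intro!: exI[of _ "d - p3"])
      ultimately show ?thesis using abcd by (auto simp del: set_drop_subset)
    qed
    have "u = ?u1 @ ?u2 @ ?u3 @ ?u4"
    proof -
      have p: "p1 \<le> p2" "p2 \<le> p3" using zones[OF xy(1) z] by auto
      have "bs = take p1 bs @ take (p2 - p1) (drop p1 bs) @ take (p3 - p2) (drop p2 bs) @ drop p3 bs"
        using p by (metis append_take_drop_id drop_drop le_add_diff_inverse2)
      then show ?thesis unfolding bs(3) by (metis concat_append)
    qed
    moreover have "x \<in> set v \<and> y \<in> set v" if "v \<in> {?u1, ?u2, ?u3, ?u4}" for v
      using that zones[OF xy(1) z] zones[OF xy(2) z[unfolded xy(3)]] by (auto simp del: set_concat)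
    ultimately have "\<not> avoids_alternations 5 u" by (rule four_zones_alternation[OF xy(4)])
    with adm show False by (simp add: admissible_def)
  qed
  then have "card (set u) \<le> card F" using h F(1) by (intro card_inj_on_le[of h]) auto
  with F(2) show ?thesis by simp
qed

section \<open>Sequences with slots\<close>

text \<open>Sequences are kept as sets of labelled positions: only the order of positions matters,
  so block indices may have gaps and ranks may be any integers, and composing needs no
  renumbering.\<close>

definition five_free :: "((nat \<times> int) \<times> nat) set \<Rightarrow> bool" where
  "five_free E \<longleftrightarrow> \<not> (\<exists>p1 p2 p3 p4 p5 x y. x \<noteq> y \<and>
     p1 < p2 \<and> p2 < p3 \<and> p3 < p4 \<and> p4 < p5 \<and>
     (p1, x) \<in> E \<and> (p2, y) \<in> E \<and> (p3, x) \<in> E \<and> (p4, y) \<in> E \<and> (p5, x) \<in> E)"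

text \<open>
  An element \<open>((b, r), x)\<close> of \<open>E\<close> is an occurrence of the letter \<open>x\<close> in block \<open>b\<close>; the rank \<open>r\<close> orders the
  letters of a block, so positions are compared lexicographically. Slot \<open>i\<close> consists of the blocks
  \<open>c i - 1\<close>, \<open>c i\<close>, \<open>c i + 1\<close>. Its core \<open>c i\<close> holds last occurrences (negative ranks) followed by
  first occurrences (nonnegative ranks). All ranks in a slot lie in \<open>[-n, n)\<close>, so rank \<open>n\<close> is behind and
  rank \<open>-1 - n\<close> in front of everything there.
\<close>

locale slotted =
  fixes E :: "((nat \<times> int) \<times> nat) set" and c :: "nat \<Rightarrow> nat" and K N n k :: nat
  assumes fin: "finite E"
    and letter_unique: "(p, x) \<in> E \<Longrightarrow> (p, y) \<in> E \<Longrightarrow> x = y"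
    and rank_unique: "((b, r), x) \<in> E \<Longrightarrow> ((b, r'), x) \<in> E \<Longrightarrow> r = r'"
    and block_less: "((b, r), x) \<in> E \<Longrightarrow> b < K"
    and core_pos: "i < N \<Longrightarrow> 1 \<le> c i"
    and core_less: "i < N \<Longrightarrow> c i + 1 < K"
    and core_gap: "i < j \<Longrightarrow> j < N \<Longrightarrow> c i + 3 \<le> c j"
    and rank_bound: "((b, r), x) \<in> E \<Longrightarrow> i < N \<Longrightarrow> c i \<le> b + 1 \<Longrightarrow> b \<le> c i + 1 \<Longrightarrow>
      - int n \<le> r \<and> r < int n"
    and first_core: "((c i, r), x) \<in> E \<Longrightarrow> i < N \<Longrightarrow> 0 \<le> r \<Longrightarrow> ((b, r'), x) \<in> E \<Longrightarrow> c i \<le> b"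
    and last_core: "((c i, r), x) \<in> E \<Longrightarrow> i < N \<Longrightarrow> r < 0 \<Longrightarrow> ((b, r'), x) \<in> E \<Longrightarrow> b \<le> c i"
    and has_first: "(p, x) \<in> E \<Longrightarrow> \<exists>i<N. \<exists>r\<ge>0. ((c i, r), x) \<in> E"
    and has_last: "(p, x) \<in> E \<Longrightarrow> \<exists>i<N. \<exists>r<0. ((c i, r), x) \<in> E"
    and enough: "(p, x) \<in> E \<Longrightarrow> k \<le> card {b. \<exists>r. ((b, r), x) \<in> E}"
    and free: "five_free E"
begin

lemma core_inj: "i < N \<Longrightarrow> j < N \<Longrightarrow> c i = c j \<longleftrightarrow> i = j"
  using core_gap[of i j] core_gap[of j i] by (cases i j rule: linorder_cases) auto

end

section \<open>Composition of two slotted sequences\<close>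

text \<open>Parity separates the letters of the outer sequence from those of the copies.\<close>

definition outer :: "nat \<Rightarrow> nat" where "outer a = 2 * a"
definition inner :: "nat \<Rightarrow> nat \<Rightarrow> nat" where "inner i v = 2 * prod_encode (i, v) + 1"

lemma outer_inner [simp]:
  "outer a = outer a' \<longleftrightarrow> a = a'" "inner i v = inner j w \<longleftrightarrow> i = j \<and> v = w"
  "outer a \<noteq> inner i v" "inner i v \<noteq> outer a"
  by (auto simp: outer_def inner_def) presburger+

lemma pair_index_less:
  fixes K :: nat
  assumes "q < K" "q' < K"
  shows "p * K + q < p' * K + q' \<longleftrightarrow> p < p' \<or> p = p' \<and> q < q'"
proof -
  have *: "x * K + y < z * K" if "x < z" "y < K" for x y z :: nat
  proof -
    have "x * K + y < Suc x * K" using that by simp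
    also have "\<dots> \<le> z * K" using that by (intro mult_right_mono) auto
    finally show ?thesis .
  qed
  show ?thesis
    using *[of p p' q] *[of p' p q'] assms by (cases p p' rule: linorder_cases) auto
qed

lemma pair_index_eq:
  fixes K :: nat
  assumes "q < K" "q' < K"
  shows "p * K + q = p' * K + q' \<longleftrightarrow> p = p' \<and> q = q'"
  using pair_index_less[OF assms, of p p'] pair_index_less[OF assms(2,1), of p' p]
  by (metis less_irrefl linorder_neqE_nat)

text \<open>\<open>t\<close> couples the two sequences: ranks in the cores of \<open>U\<close> lie
  in \<open>[-t, t)\<close>, and every copy of \<open>V\<close> offers \<open>t\<close> slots to
  receive them.\<close>

locale composition =
  U: slotted U cu KU N t k + V: slotted V cv K t n "k + 2"
  for U cu KU N t k V cv K n +
  assumes slots_pos: "1 \<le> t"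
begin

text \<open>
  A letter of \<open>U\<close> with rank \<open>r\<close> in a core goes to the end of block \<open>place r\<close> and the beginning of
  block \<open>place r + 1\<close> of the copy of \<open>V\<close>: to the core of its slot and the block behind it for a first
  occurrence, to the core and the block before it for a last one.
\<close>

definition place :: "int \<Rightarrow> nat" where
  "place r = (if 0 \<le> r then cv (nat r) else cv (nat (r + int t)) - 1)"

text \<open>Block \<open>p\<close> of \<open>U\<close> is stretched to the \<open>K\<close> indices
  from \<open>p * K\<close> on. Outside the cores only the first of these is filled, which is why
  blocks are counted by use later and not by the range of indices.\<close>

inductive_set W :: "((nat \<times> int) \<times> nat) set" where
  copy: "i < N \<Longrightarrow> ((q, r), v) \<in> V \<Longrightarrow> ((cu i * K + q, r), inner i v) \<in> W"
| mid: "((p, r), a) \<in> U \<Longrightarrow> p \<notin> cu ` {..<N} \<Longrightarrow> ((p * K, r), outer a) \<in> W"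
| left: "i < N \<Longrightarrow> ((cu i, r), a) \<in> U \<Longrightarrow> ((cu i * K + place r, int n), outer a) \<in> W"
| right: "i < N \<Longrightarrow> ((cu i, r), a) \<in> U \<Longrightarrow> ((cu i * K + (place r + 1), - 1 - int n), outer a) \<in> W"

definition cw :: "nat \<Rightarrow> nat" where "cw s = cu (s div t) * K + cv (s mod t)"

lemma K3: "3 \<le> K"
  using V.core_pos[of 0] V.core_less[of 0] slots_pos by auto

lemma core_rank: "i < N \<Longrightarrow> ((cu i, r), a) \<in> U \<Longrightarrow> - int t \<le> r \<and> r < int t"
  using U.rank_bound[of "cu i" r a i] by auto

text \<open>A first occurrence of rank \<open>r\<close> and a last one of rank \<open>r - t\<close>
  share a slot; the former takes the gap behind the core, the latter the gap before it.\<close>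

definition slot :: "int \<Rightarrow> nat" where
  "slot r = (if 0 \<le> r then nat r else nat (r + int t))"

lemma slot_less: "- int t \<le> r \<Longrightarrow> r < int t \<Longrightarrow> slot r < t"
  by (auto simp: slot_def)

lemma place_slot: "place r = (if 0 \<le> r then cv (slot r) else cv (slot r) - 1)"
  by (auto simp: slot_def place_def)

lemma place_less: "- int t \<le> r \<Longrightarrow> r < int t \<Longrightarrow> place r + 1 < K"
  using V.core_less[OF slot_less[of r]] by (auto simp: place_slot)

lemma place_near: "- int t \<le> r \<Longrightarrow> r < int t \<Longrightarrow> 
  cv (slot r) \<le> place r + 1 \<and> place r \<le> cv (slot r) \<and> 1 \<le> cv (slot r)"
  using V.core_pos[OF slot_less[of r]] by (auto simp: place_slot)

lemma place_mono:
  assumes "- int t \<le> r" "r < int t" "- int t \<le> r'" "r' < int t" "0 \<le> r \<longleftrightarrow> 0 \<le> r'" "r < r'"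
  shows "place r + 1 < place r'"
proof -
  have "slot r < slot r'" using assms by (auto simp: slot_def)
  from V.core_gap[OF this slot_less] V.core_pos[OF slot_less, of r] show ?thesis using assms by (auto simp: place_slot)
qed

text \<open>No gap is used twice. Ranks of one sign have different slots; for opposite signs, the
  gap behind a core would be the gap before a core, but cores are at least 3 apart.\<close>

lemma place_inj:
  assumes "- int t \<le> r" "r < int t" "- int t \<le> r'" "r' < int t" "place r = place r'"
  shows "r = r'"
proof -
  have "0 \<le> r \<longleftrightarrow> 0 \<le> r'"
    using assms(5) V.core_gap[of "slot r" "slot r'"] V.core_gap[of "slot r'" "slot r"]
      V.core_pos[OF slot_less[of r]] V.core_pos[OF slot_less[of r']] slot_less[of r] slot_less[of r'] assms
    by (cases "slot r" "slot r'" rule: linorder_cases) (auto simp: place_slot split: if_splits)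
  then show ?thesis
    using place_mono[of r r'] place_mono[of r' r] assms by (cases r r' rule: linorder_cases) auto
qed

lemma V_rank_place:
  assumes "((q, \<rho>), v) \<in> V" "- int t \<le> r" "r < int t" "q = place r \<or> q = place r + 1"
  shows "- int n \<le> \<rho> \<and> \<rho> < int n"
  using V.rank_bound[OF assms(1) slot_less[of r]] place_near[of r] assms by auto

lemma W_innerD:
  assumes "((B, \<rho>), inner i v) \<in> W"
  shows "i < N \<and> (\<exists>q. B = cu i * K + q \<and> q < K \<and> ((q, \<rho>), v) \<in> V)"
  using assms by cases (auto dest: V.block_less)

lemma W_outerD:
  assumes "((B, \<rho>), outer a) \<in> W"
  shows "\<exists>r. ((B div K, r), a) \<in> U \<and>
    (B div K \<notin> cu ` {..<N} \<and> B = B div K * K \<and> \<rho> = r \<or>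
     (\<exists>i<N. B div K = cu i \<and> - int t \<le> r \<and> r < int t \<and> place r + 1 < K \<and>
       (B = cu i * K + place r \<and> \<rho> = int n \<or> B = cu i * K + (place r + 1) \<and> \<rho> = -1 - int n)))"
  using assms
proof cases
  case (mid p a')
  then show ?thesis using K3 by (auto intro!: exI[of _ \<rho>])
next
  case (left i r a')
  then have r: "- int t \<le> r \<and> r < int t" using core_rank by auto
  with place_less have "place r + 1 < K" by auto
  with left r show ?thesis by (auto intro!: exI[of _ r])
next
  case (right i r a')
  then have r: "- int t \<le> r \<and> r < int t" using core_rank by auto
  with place_less have *: "place r + 1 < K" by auto
  then have "(cu i * K + (place r + 1)) div K = cu i" by (simp del: add_Suc_right)
  with right r * show ?thesis
    by (intro exI[of _ r]) auto
qed simp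

lemma W_cases:
  assumes "((B, \<rho>), x) \<in> W"
  obtains i v where "x = inner i v" | a where "x = outer a"
  using assms by cases auto

lemma W_inner_div:
  assumes "((B, \<rho>), inner i v) \<in> W"
  shows "B div K = cu i" "i < N" "((B mod K, \<rho>), v) \<in> V"
  using W_innerD[OF assms] by auto

text \<open>The new ranks \<open>int n\<close> and \<open>- 1 - int n\<close> just leave the range
  of \<open>V\<close>, so each composition raises the bound by 1.\<close>

lemma W_rank_bound:
  assumes "((B, \<rho>), x) \<in> W" "s < N * t" "cw s \<le> B + 1" "B \<le> cw s + 1"
  shows "- int (Suc n) \<le> \<rho> \<and> \<rho> < int (Suc n)"
proof -
  have s: "s div t < N" "s mod t < t"
    using assms(2) slots_pos by (auto simp: less_mult_imp_div_less)
  let ?q = "cv (s mod t)"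
  have q: "1 \<le> ?q" "?q + 1 < K" using s V.core_pos V.core_less by auto
  have "B div K = cu (s div t)" and Bm: "?q \<le> B mod K + 1 \<and> B mod K \<le> ?q + 1"
  proof -
    define d where "d = B - cu (s div t) * K"
    have B: "B = cu (s div t) * K + d" and d: "d < K" "?q \<le> d + 1" "d \<le> ?q + 1"
      using assms q by (auto simp: cw_def d_def)
    then show "B div K = cu (s div t)" "?q \<le> B mod K + 1 \<and> B mod K \<le> ?q + 1" by auto
  qed
  show ?thesis using assms(1)
  proof (cases rule: W_cases)
    case (1 i v)
    with assms W_inner_div[of B \<rho> i v] V.rank_bound[of "B mod K" \<rho> v "s mod t"] s Bm
    show ?thesis by auto
  next
    case (2 a)
    with assms(1) have "((B, \<rho>), outer a) \<in> W" by simp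
    from W_outerD[OF this] \<open>B div K = cu (s div t)\<close> s show ?thesis by auto
  qed
qed

lemma W_letter_unique: 
  assumes "(P, x) \<in> W" "(P, y) \<in> W" shows "x = y"
proof -
  obtain B \<rho> where P: "P = (B, \<rho>)" by fastforce
  \<comment> \<open>Inside a copy, an old letter has a rank that no letter of \<open>V\<close> has
    near a slot.\<close>
  have io: False if x: "((B, \<rho>), inner i v) \<in> W" and y: "((B, \<rho>), outer a) \<in> W" for i v a
  proof -
    note X = W_inner_div[OF x]
    from W_outerD[OF y] X obtain j r where "j < N" "B div K = cu j" "- int t \<le> r" "r < int t" "place r + 1 < K"
      and *: "(B = cu j * K + place r \<and> \<rho> = int n \<or> B = cu j * K + (place r + 1) \<and> \<rho> = -1 - int n)"
      by auto
    then have "B mod K = place r \<or> B mod K = place r + 1" by auto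
    from V_rank_place[OF X(3) _ _ this] \<open>- int t \<le> r\<close> \<open>r < int t\<close> * show False by auto
  qed
  from assms(1)[unfolded P] show ?thesis
  proof (cases rule: W_cases)
    case (1 i v)
    from assms(2)[unfolded P] show ?thesis
    proof (cases rule: W_cases)
      case 2 with io[of i v] 1 assms P show ?thesis by auto
    next
      case (1 j w)
      with \<open>x = inner i v\<close> assms P have "((B, \<rho>), inner i v) \<in> W" "((B, \<rho>), inner j w) \<in> W" by auto
      from W_inner_div[OF this(1)] W_inner_div[OF this(2)] U.core_inj V.letter_unique \<open>x = inner i v\<close> 1
      show ?thesis by auto
    qed
  next
    case (2 a)
    from assms(2)[unfolded P] show ?thesis
    proof (cases rule: W_cases)
      case (1 j w) with io[of j w] 2 assms P show ?thesis by auto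
    next
      case (2 b)
      with \<open>x = outer a\<close> assms P have "((B, \<rho>), outer a) \<in> W" "((B, \<rho>), outer b) \<in> W" by auto
      from W_outerD[OF this(1)] W_outerD[OF this(2)] obtain r r' where r: "((B div K, r), a) \<in> U"
        "((B div K, r'), b) \<in> U" "r = r'"
        by (fastforce dest: place_inj)
      with U.letter_unique \<open>x = outer a\<close> 2 show ?thesis by auto
    qed
  qed
qed

lemma W_rank_unique:
  assumes "((B, \<rho>), x) \<in> W" "((B, \<rho>'), x) \<in> W"
  shows "\<rho> = \<rho>'"
  using assms(1)
proof (cases rule: W_cases)
  case (1 i v)
  with assms W_inner_div[of B _ i v] V.rank_unique show ?thesis by blast
next
  case (2 a)
  with assms have "((B, \<rho>), outer a) \<in> W" "((B, \<rho>'), outer a) \<in> W" by auto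
  from W_outerD[OF this(1)] W_outerD[OF this(2)] show ?thesis
    by (fastforce dest: U.rank_unique)
qed

lemma W_block_less:
  assumes "((B, \<rho>), x) \<in> W" shows "B < KU * K"
proof -
  have "B div K < KU"
    using assms
  proof (cases rule: W_cases)
    case (1 i v)
    with assms W_inner_div[of B _ i v] U.core_less[of i] show ?thesis by auto
  next
    case (2 a)
    with assms W_outerD[of B \<rho> a] U.block_less show ?thesis by blast
  qed
  then show ?thesis using K3 by (simp add: div_less_iff_less_mult)
qed

text \<open>The two halves of a doubled occurrence are the last position of one block and the first
  position of the next: by \<open>W_rank_bound\<close> no rank there is beyond theirs.\<close>

lemma W_adjacent:
  assumes a: "((B, \<rho>), outer a) \<in> W" "((B', \<rho>'), outer a) \<in> W" and z: "(Q, z) \<in> W"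
    and i: "i < N" "B div K = cu i" "B' div K = cu i"
    and lt: "(B, \<rho>) < Q" "Q < (B', \<rho>')"
  shows False
proof -
  from W_outerD[OF a(1)] W_outerD[OF a(2)] i obtain r where r: "((cu i, r), a) \<in> U" "- int t \<le> r" "r < int t"
    "place r + 1 < K"
    "B = cu i * K + place r \<and> \<rho> = int n \<or> B = cu i * K + (place r + 1) \<and> \<rho> = -1 - int n"
    "B' = cu i * K + place r \<and> \<rho>' = int n \<or> B' = cu i * K + (place r + 1) \<and> \<rho>' = -1 - int n"
    by (fastforce dest: U.rank_unique)
  have "(B, \<rho>) < (B', \<rho>')" using lt by (rule less_trans)
  then have BB: "B = cu i * K + place r" "\<rho> = int n" "B' = B + 1" "\<rho>' = -1 - int n"
    using r(5,6) by auto
  obtain Bq \<sigma> where Q: "Q = (Bq, \<sigma>)" by fastforce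
  have 1: "Bq = B \<and> \<sigma> > int n \<or> Bq = B + 1 \<and> \<sigma> < -1 - int n"
    using lt BB Q by auto
  define s where "s = i * t + slot r"
  have sl: "slot r < t" using slot_less r by auto
  then have "s div t = i" "s mod t = slot r" by (auto simp: s_def)
  moreover have "s < N * t" unfolding s_def using i(1) sl pair_index_less[of "slot r" t 0 i N] by auto
  ultimately have "cw s = cu i * K + cv (slot r)" "s < N * t" by (auto simp: cw_def)
  with W_rank_bound[of Bq \<sigma> z s] z Q 1 BB place_near[of r] r(2,3)
  show False by auto
qed

text \<open>\<open>place\<close> is increasing on the ranks of each sign, but a first and a last
  occurrence of one core may come out in either order; \<open>nomix\<close> excludes such
  pairs.\<close>

lemma W_outer_step:
  assumes a: "((B, \<rho>), outer a) \<in> W" "((B', \<rho>'), outer b) \<in> W"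
    and r: "((B div K, r), a) \<in> U" "((B' div K, r'), b) \<in> U"
    and lt: "(B, \<rho>) < (B', \<rho>')" and "a \<noteq> b"
    and nomix: "\<And>i. i < N \<Longrightarrow> ((cu i, r), a) \<in> U \<Longrightarrow> ((cu i, r'), b) \<in> U \<Longrightarrow> 0 \<le> r \<longleftrightarrow> 0 \<le> r'"
  shows "(B div K, r) < (B' div K, r')"
proof -
  have "B div K \<le> B' div K" using lt by (auto intro: div_le_mono)
  show ?thesis
  proof (cases "B div K = B' div K")
    case False
    with \<open>B div K \<le> B' div K\<close> show ?thesis by auto
  next
    case True
    from W_outerD[OF a(1)] U.rank_unique[OF r(1)] have A:
      "(B div K \<notin> cu ` {..<N} \<and> B = B div K * K \<and> \<rho> = r \<or>
     (\<exists>i<N. B div K = cu i \<and> - int t \<le> r \<and> r < int t \<and> place r + 1 < K \<and>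
       (B = cu i * K + place r \<and> \<rho> = int n \<or> B = cu i * K + (place r + 1) \<and> \<rho> = -1 - int n)))" by metis
    from W_outerD[OF a(2)] U.rank_unique[OF r(2)] have A':
      "(B' div K \<notin> cu ` {..<N} \<and> B' = B' div K * K \<and> \<rho>' = r' \<or>
     (\<exists>i<N. B' div K = cu i \<and> - int t \<le> r' \<and> r' < int t \<and> place r' + 1 < K \<and>
       (B' = cu i * K + place r' \<and> \<rho>' = int n \<or> B' = cu i * K + (place r' + 1) \<and> \<rho>' = -1 - int n)))" by metis
    show ?thesis
    proof (cases "B div K \<in> cu ` {..<N}")
      case False
      with A A' True have "B = B div K * K" "B' = B div K * K" "\<rho> = r" "\<rho>' = r'" by auto
      then have "B = B'" by linarith
      with lt True \<open>\<rho> = r\<close> \<open>\<rho>' = r'\<close> show ?thesis by auto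
    next
      case core: True
      then obtain i where i: "i < N" "B div K = cu i" by auto
      have *: "- int t \<le> r" "r < int t" "- int t \<le> r'" "r' < int t"
        "B = cu i * K + place r \<or> B = cu i * K + (place r + 1)"
        "B' = cu i * K + place r' \<or> B' = cu i * K + (place r' + 1)"
        using A A' core True i by auto
      have "0 \<le> r \<longleftrightarrow> 0 \<le> r'" using nomix[OF i(1)] r i True by auto
      moreover have "r \<noteq> r'" using U.letter_unique r True \<open>a \<noteq> b\<close> by metis
      moreover have "B \<le> B'" using lt by auto
      ultimately show ?thesis using place_mono[of r' r] * True
        by (cases r r' rule: linorder_cases) auto
    qed
  qed
qed

lemma W_div_mono: "((B::nat), (\<rho>::int)) < (B', \<rho>') \<Longrightarrow> B div K \<le> B' div K"
  by (auto intro: div_le_mono)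

text \<open>
  Projecting the old letters back to \<open>U\<close> preserves the order except between a first and a last
  occurrence in the same core; such a pair has all of the second letter before the end of the copy and
  all of the first one after its beginning, which leaves too little room.
\<close>

lemma W_free: "five_free W"
  unfolding five_free_def
proof (intro notI, elim exE conjE)
  fix p1 p2 p3 p4 p5 x y
  assume xy: "x \<noteq> y" and lt: "p1 < p2" "p2 < p3" "p3 < p4" "p4 < p5"
    and W: "(p1, x) \<in> W" "(p2, y) \<in> W" "(p3, x) \<in> W" "(p4, y) \<in> W" "(p5, x) \<in> W"
  obtain B1 \<rho>1 B2 \<rho>2 B3 \<rho>3 B4 \<rho>4 B5 \<rho>5 where P: "p1 = (B1, \<rho>1)" "p2 = (B2, \<rho>2)" "p3 = (B3, \<rho>3)"
    "p4 = (B4, \<rho>4)" "p5 = (B5, \<rho>5)" by fastforce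
  note W = W[unfolded P] and lt = lt[unfolded P]
  have div: "B1 div K \<le> B2 div K" "B2 div K \<le> B3 div K" "B3 div K \<le> B4 div K" "B4 div K \<le> B5 div K"
    using lt[THEN W_div_mono] by auto
  note adj12 = W_adjacent[OF _ _ _ _ _ _ lt(1,2)]
    and adj23 = W_adjacent[OF _ _ _ _ _ _ lt(2,3)] and adj34 = W_adjacent[OF _ _ _ _ _ _ lt(3,4)]
  consider i v j w where "x = inner i v" "y = inner j w" | i v a where "x = inner i v" "y = outer a"
    | a i v where "x = outer a" "y = inner i v" | a b where "x = outer a" "y = outer b"
    using W(1,2) by (meson W_cases)
  then show False
  proof cases
    \<comment> \<open>As the letters alternate and \<open>B div K\<close> is monotone, both belong
      to the same copy, where \<open>V.free\<close> applies.\<close>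
    case (1 i v j w)
    note D = W[unfolded 1, THEN W_inner_div(1)] W[unfolded 1, THEN W_inner_div(2)]
    have "cu i = cu j" using D div by linarith
    then have "i = j" using D U.core_inj by auto
    then have "v \<noteq> w" using xy 1 by auto
    have less: "(B mod K, \<rho>) < (B' mod K, \<rho>')" if "(B, \<rho>) < (B', \<rho>')" "B div K = B' div K" 
      for B B' and \<rho> \<rho>' :: int
    proof (cases "B = B'")
      case False
      with that have "B < B'" by auto
      moreover have "B div K * K + B mod K = B" "B' div K * K + B' mod K = B'" by auto
      ultimately have "B mod K < B' mod K" using that(2) by (metis add_less_cancel_left)
      then show ?thesis by auto
    qed (use that in auto)
    from lt[THEN less] D \<open>i = j\<close> W[unfolded 1, THEN W_inner_div(3)] V.free \<open>v \<noteq> w\<close>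
    show False unfolding five_free_def by metis
  next
    \<comment> \<open>\<open>p2\<close> and \<open>p4\<close> are trapped in the copy that contains
      \<open>x\<close>, so they are adjacent halves with \<open>p3\<close> between them.\<close>
    case (2 i v a)
    note D = W(1,3,5)[unfolded 2, THEN W_inner_div(1)] W(1)[unfolded 2, THEN W_inner_div(2)]
    have "B2 div K = cu i" "B4 div K = cu i" using D div by linarith+
    with adj23[OF W(2)[unfolded 2] W(4)[unfolded 2] W(3)] D show False by auto
  next
    \<comment> \<open>\<open>p3\<close> is trapped in the copy, hence half of a first or a last
      occurrence of \<open>a\<close>. A first one forces \<open>p1\<close> into the copy too, a last
      one forces \<open>p5\<close>; then two adjacent halves have an occurrence of \<open>y\<close>
      between them.\<close>
    case (3 a i v)
    note D = W(2,4)[unfolded 3, THEN W_inner_div(1)] W(2)[unfolded 3, THEN W_inner_div(2)]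
    have d3: "B3 div K = cu i" using D div by linarith
    from W_outerD[OF W(3)[unfolded 3]] d3 obtain r where r: "((cu i, r), a) \<in> U" by auto
    show False
    proof (cases "0 \<le> r")
      case True
      from W_outerD[OF W(1)[unfolded 3]] obtain r1 where "((B1 div K, r1), a) \<in> U" by auto
      from U.first_core[OF r D(3) True this] div D have "B1 div K = cu i" by auto
      with adj12[OF W(1)[unfolded 3] W(3)[unfolded 3] W(2)] D d3 show False by auto
    next
      case False
      from W_outerD[OF W(5)[unfolded 3]] obtain r1 where "((B5 div K, r1), a) \<in> U" by auto
      from U.last_core[OF r D(3) _ this] False div D have "B5 div K = cu i" by auto
      with adj34[OF W(3)[unfolded 3] W(5)[unfolded 3] W(4)] D d3 show False by auto
    qed
  next
    case (4 a b)
    then have ab: "a \<noteq> b" using xy by auto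
    note W = W[unfolded 4]
    obtain r1 r2 r3 r4 r5 where r: "((B1 div K, r1), a) \<in> U" "((B2 div K, r2), b) \<in> U"
      "((B3 div K, r3), a) \<in> U" "((B4 div K, r4), b) \<in> U" "((B5 div K, r5), a) \<in> U"
      using W[THEN W_outerD] by metis
    have no1: False if i: "i < N" "((cu i, s), a) \<in> U" "0 \<le> s" "((cu i, s'), b) \<in> U" "s' < 0" for i s s'
    proof -
      have "cu i \<le> B1 div K" using U.first_core[OF i(2,1,3) r(1)] .
      moreover have "B4 div K \<le> cu i" using U.last_core[OF i(4,1,5) r(4)] .
      ultimately have "B1 div K = cu i" "B3 div K = cu i" using div by linarith+
      with adj12[OF W(1,3,2) i(1)] show False by auto
    qed
    have no2: False if i: "i < N" "((cu i, s), b) \<in> U" "0 \<le> s" "((cu i, s'), a) \<in> U" "s' < 0" for i s s'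
    proof -
      have "cu i \<le> B2 div K" using U.first_core[OF i(2,1,3) r(2)] .
      moreover have "B5 div K \<le> cu i" using U.last_core[OF i(4,1,5) r(5)] .
      ultimately have "B2 div K = cu i" "B4 div K = cu i" using div by linarith+
      with adj23[OF W(2,4,3) i(1)] show False by auto
    qed
    have nm: "0 \<le> s \<longleftrightarrow> 0 \<le> s'" if "i < N" "((cu i, s), a) \<in> U" "((cu i, s'), b) \<in> U" for i s s'
      using no1[OF that(1,2) _ that(3)] no2[OF that(1,3) _ that(2)] by (meson not_less)
    have "(B1 div K, r1) < (B2 div K, r2)" "(B3 div K, r3) < (B4 div K, r4)"
      using W_outer_step[OF W(1,2) r(1,2) lt(1) ab nm] W_outer_step[OF W(3,4) r(3,4) lt(3) ab nm] by auto
    moreover have "(B2 div K, r2) < (B3 div K, r3)" "(B4 div K, r4) < (B5 div K, r5)"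
      using W_outer_step[OF W(2,3) r(2,3) lt(2) ab[symmetric] nm[symmetric]] 
        W_outer_step[OF W(4,5) r(4,5) lt(4) ab[symmetric] nm[symmetric]] by auto
    ultimately show False using U.free r ab unfolding five_free_def by metis
  qed
qed

lemma cw_slot:
  assumes "s < N * t"
  shows "s div t < N" "s mod t < t"
  using assms slots_pos by (auto simp: less_mult_imp_div_less)

lemma cw_div:
  assumes "s < N * t"
  shows "cw s div K = cu (s div t)" "cw s mod K = cv (s mod t)"
  using V.core_less[OF cw_slot(2)[OF assms]] by (auto simp: cw_def)

text \<open>The half of an old letter that falls into a new core is the earlier half of a first
  occurrence, with rank \<open>int n\<close>, or the later half of a last one, with rank
  \<open>- 1 - int n\<close>. So the sign of the rank still tells first from last.\<close>

lemma W_first_last_core: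
  assumes core: "((cw s, \<rho>), x) \<in> W" "s < N * t" and other: "((B, \<rho>'), x) \<in> W"
  shows "if 0 \<le> \<rho> then cw s \<le> B else B \<le> cw s"
  using core(1)
proof (cases rule: W_cases)
  case (1 i v)
  note X = W_inner_div[OF core(1)[unfolded 1]] and Y = W_inner_div[OF other[unfolded 1]]
  note X = X[unfolded cw_div[OF core(2)]]
  have "if 0 \<le> \<rho> then cv (s mod t) \<le> B mod K else B mod K \<le> cv (s mod t)"
    using V.first_core[OF X(3) cw_slot(2)[OF core(2)] _ Y(3)]
      V.last_core[OF X(3) cw_slot(2)[OF core(2)] _ Y(3)] by auto
  moreover have "cw s = cu i * K + cv (s mod t)" using X by (simp add: cw_def)
  moreover have "B = cu i * K + B mod K" using Y(1) by (metis div_mult_mod_eq)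
  ultimately show ?thesis by (metis add_le_cancel_left)
next
  case (2 a)
  define i where "i = s div t"
  have i: "i < N" and j: "s mod t < t" and cs: "cw s = cu i * K + cv (s mod t)"
    using cw_slot[OF core(2)] by (auto simp: i_def cw_def)
  from W_outerD[OF core(1)[unfolded 2]] cw_div[OF core(2)] i obtain r where
    r: "((cu i, r), a) \<in> U" "- int t \<le> r" "r < int t" and
    "cw s = cu i * K + place r \<and> \<rho> = int n \<or> cw s = cu i * K + (place r + 1) \<and> \<rho> = -1 - int n"
    unfolding i_def by auto
  then have pl: "cv (s mod t) = place r \<and> \<rho> = int n \<or> cv (s mod t) = place r + 1 \<and> \<rho> = -1 - int n"
    unfolding cs by linarith
  have sl: "slot r < t" using r slot_less by auto
  \<comment> \<open>The half beside its core is not in another core, as cores are at least 3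
    apart.\<close>
  have sign: "0 \<le> r \<longleftrightarrow> 0 \<le> \<rho>"
    using pl V.core_pos[OF sl] V.core_gap[of "slot r" "s mod t"] V.core_gap[of "s mod t" "slot r"] j sl
    by (cases "slot r" "s mod t" rule: linorder_cases) (auto simp: place_slot split: if_splits)
  from W_outerD[OF other[unfolded 2]] obtain r' where r': "((B div K, r'), a) \<in> U" and
    B: "B div K = cu i \<Longrightarrow> (B = cu i * K + place r' \<or> B = cu i * K + (place r' + 1))"
    using i by fastforce
  show ?thesis
  proof (cases "B div K = cu i")
    case True
    then have "r' = r" using U.rank_unique r r' by metis
    with B[OF True] pl cs sign show ?thesis by auto
  next
    case False
    then have "if 0 \<le> \<rho> then cw s div K < B div K else B div K < cw s div K"
      using U.first_core[OF r(1) i _ r'] U.last_core[OF r(1) i _ r'] sign cw_div[OF core(2)]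
      by (auto simp: i_def)
    then show ?thesis by (metis div_le_mono linorder_not_less nless_le)
  qed
qed

lemma cw_gap:
  assumes "s < s'" "s' < N * t"
  shows "cw s + 3 \<le> cw s'"
proof -
  have s: "s < N * t" using assms by simp
  show ?thesis
  proof (cases "s div t = s' div t")
    case True
    have "s div t * t + s mod t = s" "s' div t * t + s' mod t = s'" by auto
    then have "s mod t < s' mod t" using True assms(1) by (metis add_less_cancel_left)
    from V.core_gap[OF this cw_slot(2)[OF assms(2)]] show ?thesis using True by (simp add: cw_def)
  next
    case False
    then have "s div t < s' div t" using assms(1) by (simp add: div_le_mono le_neq_implies_less)
    from U.core_gap[OF this cw_slot(1)[OF assms(2)]]
    have "(cu (s div t) + 3) * K \<le> cu (s' div t) * K" by (rule mult_right_mono) auto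
    then show ?thesis using V.core_less[OF cw_slot(2)[OF s]] K3 by (auto simp: cw_def algebra_simps)
  qed
qed

lemma slot_index:
  assumes "i < N" "j < t"
  shows "i * t + j < N * t" "cw (i * t + j) = cu i * K + cv j"
  using assms pair_index_less[of j t 0 i N] by (auto simp: cw_def)

lemma W_has_first_last:
  assumes "(P, x) \<in> W"
  shows "(\<exists>s<N * t. \<exists>\<rho>\<ge>0. ((cw s, \<rho>), x) \<in> W) \<and> (\<exists>s<N * t. \<exists>\<rho><0. ((cw s, \<rho>), x) \<in> W)"
proof -
  obtain B \<rho> where P: "P = (B, \<rho>)" by fastforce
  from assms[unfolded P] show ?thesis
  proof (cases rule: W_cases)
    case (1 i v)
    note X = W_inner_div[OF assms[unfolded P 1]]
    from V.has_first[OF X(3)] obtain j r where j: "j < t" "0 \<le> r" "((cv j, r), v) \<in> V" by auto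
    from V.has_last[OF X(3)] obtain j' r' where j': "j' < t" "r' < 0" "((cv j', r'), v) \<in> V" by auto
    have "((cw (i * t + j), r), x) \<in> W" "((cw (i * t + j'), r'), x) \<in> W"
      using W.copy[OF X(2) j(3)] W.copy[OF X(2) j'(3)] slot_index X(2) j j' 1 by auto
    with j j' slot_index(1)[OF X(2)] show ?thesis by blast
  next
    case (2 a)
    from W_outerD[OF assms[unfolded P 2]] obtain p where p: "(p, a) \<in> U" by auto
    from U.has_first[OF p] obtain i r where i: "i < N" "0 \<le> r" "((cu i, r), a) \<in> U" by auto
    from U.has_last[OF p] obtain i' r' where i': "i' < N" "r' < 0" "((cu i', r'), a) \<in> U" by auto
    note r = core_rank[OF i(1,3)] and r' = core_rank[OF i'(1,3)]
    have sl: "slot r < t" "slot r' < t" using r r' slot_less by auto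
    have "place r' + 1 = cv (slot r')" "place r = cv (slot r)" 
      using i i' V.core_pos[OF sl(2)] by (auto simp: place_slot)
    then have "((cw (i * t + slot r), int n), x) \<in> W" "((cw (i' * t + slot r'), - 1 - int n), x) \<in> W"
      using W.left[OF i(1,3)] W.right[OF i'(1,3)] slot_index i i' sl 2 by auto
    moreover have "i * t + slot r < N * t" "i' * t + slot r' < N * t"
      using slot_index(1)[OF i(1) sl(1)] slot_index(1)[OF i'(1) sl(2)] .
    moreover have "0 \<le> int n" "- 1 - int n < 0" by auto
    ultimately show ?thesis by blast
  qed
qed

text \<open>For an old letter, the first and the last occurrence lie in different cores and all
  others outside the cores. Doubling these two replaces two blocks by four.\<close>

lemma W_enough:
  assumes "(P, x) \<in> W"
  shows "k + 2 \<le> card {B. \<exists>\<rho>. ((B, \<rho>), x) \<in> W}"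
proof -
  let ?S = "{B. \<exists>\<rho>. ((B, \<rho>), x) \<in> W}"
  have fin: "finite ?S"
    by (rule finite_subset[of _ "{..<KU * K}"]) (auto dest: W_block_less)
  obtain B \<rho> where P: "P = (B, \<rho>)" by fastforce
  from assms[unfolded P] show ?thesis
  proof (cases rule: W_cases)
    case (1 i v)
    note X = W_inner_div[OF assms[unfolded P 1]]
    have "k + 2 \<le> card {b. \<exists>r. ((b, r), v) \<in> V}" using V.enough[OF X(3)] .
    also have "\<dots> \<le> card ?S"
      by (rule card_inj_on_le[of "\<lambda>q. cu i * K + q"]) (use fin W.copy[OF X(2)] 1 in \<open>auto simp: inj_on_def\<close>)
    finally show ?thesis .
  next
    case (2 a)
    from W_outerD[OF assms[unfolded P 2]] obtain p where p: "(p, a) \<in> U" by auto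
    let ?A = "{b. \<exists>r. ((b, r), a) \<in> U}"
    from U.has_first[OF p] obtain i r where i: "i < N" "0 \<le> r" "((cu i, r), a) \<in> U" by auto
    from U.has_last[OF p] obtain i' r' where i': "i' < N" "r' < 0" "((cu i', r'), a) \<in> U" by auto
    note r = core_rank[OF i(1,3)] and r' = core_rank[OF i'(1,3)]
    have finA: "finite ?A" by (rule finite_subset[of _ "{..<KU}"]) (auto dest: U.block_less)
    have ne: "cu i \<noteq> cu i'" using i i' U.rank_unique[of "cu i" r a r'] by auto
    have mid: "b \<notin> cu ` {..<N}" if b: "b \<in> ?A - {cu i, cu i'}" for b
    proof
      assume "b \<in> cu ` {..<N}"
      moreover obtain s where "((b, s), a) \<in> U" using b by auto
      ultimately obtain j where j: "j < N" "((cu j, s), a) \<in> U" "b = cu j" by auto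
      show False
      proof (cases "0 \<le> s")
        case True
        with U.first_core[OF j(2,1) _ i(3)] U.first_core[OF i(3,1,2) j(2)] j b show False by auto
      next
        case False
        with U.last_core[OF j(2,1) _ i'(3)] U.last_core[OF i'(3,1,2) j(2)] j b show False by auto
      qed
    qed
    let ?f = "\<lambda>b. b * K" and ?C = "{cu i * K + place r, cu i * K + (place r + 1),
      cu i' * K + place r', cu i' * K + (place r' + 1)}"
    have pl: "place r + 1 < K" "place r' + 1 < K" using place_less r r' by auto
    have "cu i * K + x \<noteq> cu i' * K + y" if "x < K" "y < K" for x y
      using pair_index_eq[OF that] ne by auto
    from this[of "place r" "place r'"] this[of "place r" "place r' + 1"]
      this[of "place r + 1" "place r'"] this[of "place r + 1" "place r' + 1"] pl
    have "card ?C = 4" by auto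
    have "?f ` (?A - {cu i, cu i'}) \<inter> ?C = {}"
    proof -
      have False if "b * K \<in> ?C" "b \<in> ?A - {cu i, cu i'}" for b
        using that pl pair_index_eq[of 0 K "place r" b "cu i"] pair_index_eq[of 0 K "place r + 1" b "cu i"]
          pair_index_eq[of 0 K "place r'" b "cu i'"] pair_index_eq[of 0 K "place r' + 1" b "cu i'"]
        by auto
      then show ?thesis by blast
    qed
    moreover have "card (?f ` (?A - {cu i, cu i'})) = card ?A - 2"
    proof -
      have "inj_on ?f (?A - {cu i, cu i'})" using K3 by (auto simp: inj_on_def)
      then have "card (?f ` (?A - {cu i, cu i'})) = card (?A - {cu i, cu i'})" by (rule card_image)
      also have "\<dots> = card ?A - card {cu i, cu i'}" using finA i i' by (intro card_Diff_subset) auto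
      finally show ?thesis using ne by simp
    qed
    moreover have "?f ` (?A - {cu i, cu i'}) \<union> ?C \<subseteq> ?S"
    proof (intro Un_least image_subsetI)
      show "?C \<subseteq> ?S"
        using W.left[OF i(1,3)] W.right[OF i(1,3)] W.left[OF i'(1,3)] W.right[OF i'(1,3)] 2 by auto
      fix b assume b: "b \<in> ?A - {cu i, cu i'}"
      then obtain s where "((b, s), a) \<in> U" by auto
      from W.mid[OF this mid[OF b]] show "b * K \<in> ?S" using 2 by auto
    qed
    then have "card (?f ` (?A - {cu i, cu i'}) \<union> ?C) \<le> card ?S" using fin by (rule card_mono[rotated])
    moreover have "card (?f ` (?A - {cu i, cu i'}) \<union> ?C) = card (?f ` (?A - {cu i, cu i'})) + card ?C"
      by (rule card_Un_disjoint) (use finA calculation(1) in auto)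
    ultimately show ?thesis using U.enough[OF p] \<open>card ?C = 4\<close> by linarith
  qed
qed

definition ranks :: "int set" where
  "ranks = (snd \<circ> fst) ` V \<union> (snd \<circ> fst) ` U \<union> {int n, -1 - int n}"

definition letters :: "nat set" where
  "letters = (\<Union>i<N. inner i ` snd ` V) \<union> outer ` snd ` U"

lemma W_letters:
  assumes "((B, \<rho>), x) \<in> W"
  shows "\<rho> \<in> ranks" "x \<in> letters"
proof -
  have "\<rho> \<in> ranks \<and> x \<in> letters"
    using assms
  proof (cases rule: W_cases)
    case (1 i v)
    note X = W_inner_div[OF assms[unfolded 1]]
    have "\<rho> \<in> (snd \<circ> fst) ` V" using X(3) by (rule rev_image_eqI) simp
    moreover have "v \<in> snd ` V" using X(3) by (rule rev_image_eqI) simp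
    ultimately show ?thesis using X(2) 1 unfolding ranks_def letters_def by blast
  next
    case (2 a)
    obtain r where r: "((B div K, r), a) \<in> U" "\<rho> = r \<or> \<rho> = int n \<or> \<rho> = -1 - int n"
      using W_outerD[OF assms[unfolded 2]] by blast
    have "r \<in> (snd \<circ> fst) ` U" using r(1) by (rule rev_image_eqI) simp
    moreover have "a \<in> snd ` U" using r(1) by (rule rev_image_eqI) simp
    ultimately show ?thesis using r(2) 2 unfolding ranks_def letters_def by blast
  qed
  then show "\<rho> \<in> ranks" "x \<in> letters" by auto
qed

lemma W_finite: "finite W"
proof (rule finite_subset)
  show "W \<subseteq> ({..<KU * K} \<times> ranks) \<times> letters"
    using W_block_less W_letters by auto
  show "finite (({..<KU * K} \<times> ranks) \<times> letters)"
    using U.fin V.fin by (simp add: ranks_def letters_def)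
qed

lemma W_slotted: "slotted W cw (KU * K) (N * t) (Suc n) (k + 2)"
proof
  fix s assume s: "s < N * t"
  show "1 \<le> cw s" using V.core_pos[OF cw_slot(2)[OF s]] by (auto simp: cw_def)
  have "cu (s div t) + 1 \<le> KU" using U.core_less[OF cw_slot(1)[OF s]] by simp
  then have "(cu (s div t) + 1) * K \<le> KU * K" by (rule mult_right_mono) auto
  then show "cw s + 1 < KU * K" using V.core_less[OF cw_slot(2)[OF s]] by (auto simp: cw_def)
next
  fix s \<rho> x B \<rho>' assume *: "((cw s, \<rho>), x) \<in> W" "s < N * t" "((B, \<rho>'), x) \<in> W"
  show "0 \<le> \<rho> \<Longrightarrow> cw s \<le> B" "\<rho> < 0 \<Longrightarrow> B \<le> cw s" 
    using W_first_last_core[OF *] by auto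
next
  fix P x assume *: "(P, x) \<in> W"
  show "\<exists>s<N * t. \<exists>\<rho>\<ge>0. ((cw s, \<rho>), x) \<in> W" "\<exists>s<N * t. \<exists>\<rho><0. ((cw s, \<rho>), x) \<in> W"
    using W_has_first_last[OF *] by auto
  show "k + 2 \<le> card {B. \<exists>\<rho>. ((B, \<rho>), x) \<in> W}" using W_enough[OF *] .
next
  show "finite W" by (rule W_finite)
next
  show "five_free W" by (rule W_free)
next
  fix p x y assume "(p, x) \<in> W" "(p, y) \<in> W" then show "x = y" by (rule W_letter_unique)
next
  fix b r x r' assume "((b, r), x) \<in> W" "((b, r'), x) \<in> W" then show "r = r'" by (rule W_rank_unique)
next
  fix b r x assume "((b, r), x) \<in> W" then show "b < KU * K" by (rule W_block_less)
next
  fix i j assume "i < j" "j < N * t" then show "cw i + 3 \<le> cw j" by (rule cw_gap)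
next
  fix b r x i assume "((b, r), x) \<in> W" "i < N * t" "cw i \<le> b + 1" "b \<le> cw i + 1"
  then show "- int (Suc n) \<le> r \<and> r < int (Suc n)" by (rule W_rank_bound)
qed

end

section \<open>Counting letters and blocks\<close>

text \<open>The blocks of a slot count even when empty, since a later composition may put letters
  into them; thus hosting old letters adds no block to a copy.\<close>

definition slot_blocks :: "((nat \<times> int) \<times> nat) set \<Rightarrow> (nat \<Rightarrow> nat) \<Rightarrow> nat \<Rightarrow> nat set" where
  "slot_blocks E c N = (fst \<circ> fst) ` E \<union> (\<Union>i<N. {c i - 1, c i, c i + 1})"

context composition begin

lemma W_card_letters: "card (snd ` U) + N * card (snd ` V) \<le> card (snd ` W)"
proof -
  let ?I = "(\<Union>i<N. inner i ` snd ` V)"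
  have finV: "finite (snd ` V)" and finU: "finite (snd ` U)" and finW: "finite (snd ` W)"
    using V.fin U.fin W_finite by auto
  have "card ?I = (\<Sum>i<N. card (inner i ` snd ` V))"
    by (intro card_UN_disjoint) (use finV in auto)
  also have "\<dots> = N * card (snd ` V)"
    by (subst card_image) (auto simp: inj_on_def)
  finally have I: "card ?I = N * card (snd ` V)" .
  have O: "card (outer ` snd ` U) = card (snd ` U)" by (rule card_image) (auto simp: inj_on_def)
  have sub: "outer ` snd ` U \<subseteq> snd ` W"
  proof (intro image_subsetI)
    fix z assume "z \<in> snd ` U"
    then obtain p where "(p, z) \<in> U" by (metis imageE prod.collapse)
    from U.has_first[OF this] obtain i r where "i < N" "((cu i, r), z) \<in> U" by auto
    from W.left[OF this] show "outer z \<in> snd ` W" by (rule rev_image_eqI) simp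
  qed
  have "?I \<subseteq> snd ` W"
  proof (intro UN_least image_subsetI)
    fix i v assume i: "i \<in> {..<N}" "v \<in> snd ` V"
    then obtain q r where "((q, r), v) \<in> V" by (metis imageE prod.collapse)
    with i W.copy show "inner i v \<in> snd ` W" by (metis lessThan_iff rev_image_eqI snd_conv)
  qed
  with sub have "card (outer ` snd ` U \<union> ?I) \<le> card (snd ` W)" using finW by (intro card_mono) auto
  moreover have "card (outer ` snd ` U \<union> ?I) = card (outer ` snd ` U) + card ?I"
    using finU finV by (intro card_Un_disjoint) auto
  ultimately show ?thesis using I O by simp
qed

lemma W_card_blocks:
  "card (slot_blocks W cw (N * t)) \<le> card (slot_blocks U cu N) + N * card (slot_blocks V cv t)"
proof -
  let ?C = "\<Union>i<N. (\<lambda>q. cu i * K + q) ` slot_blocks V cv t"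
  let ?M = "(\<lambda>p. p * K) ` slot_blocks U cu N"
  have finV: "finite (slot_blocks V cv t)" and finU: "finite (slot_blocks U cu N)"
    using U.fin V.fin by (auto simp: slot_blocks_def)
  have core: "{cv (slot r) - 1, cv (slot r), cv (slot r) + 1} \<subseteq> slot_blocks V cv t"
    if "- int t \<le> r" "r < int t" for r
    using slot_less[OF that] unfolding slot_blocks_def by blast
  have place: "place r \<in> slot_blocks V cv t" "place r + 1 \<in> slot_blocks V cv t"
    if "- int t \<le> r" "r < int t" for r
    using core[OF that] place_near[OF that] by (auto simp: place_slot)
  have "slot_blocks W cw (N * t) \<subseteq> ?C \<union> ?M"
  proof -
    have "B \<in> ?C \<union> ?M" if W: "((B, \<rho>), x) \<in> W" for B \<rho> x
      using W
    proof (cases rule: W_cases)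
      case (1 i v)
      from W_innerD[OF W[unfolded 1]] obtain q where q: "i < N" "B = cu i * K + q" "((q, \<rho>), v) \<in> V" by auto
      from q(3) have "q \<in> (fst \<circ> fst) ` V" by (rule rev_image_eqI) simp
      then have "q \<in> slot_blocks V cv t" by (simp add: slot_blocks_def)
      with q show ?thesis by blast
    next
      case (2 a)
      from W_outerD[OF W[unfolded 2]] obtain r where r: "((B div K, r), a) \<in> U"
        "(B = B div K * K \<or>
     (\<exists>i<N. - int t \<le> r \<and> r < int t \<and>
       (B = cu i * K + place r \<or> B = cu i * K + (place r + 1))))" by blast
      from r(1) have "B div K \<in> (fst \<circ> fst) ` U" by (rule rev_image_eqI) simp
      then have "B div K \<in> slot_blocks U cu N" by (simp add: slot_blocks_def)
      moreover have "B \<in> ?C" if "i < N" "q \<in> slot_blocks V cv t" "B = cu i * K + q" for i q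
        using that by blast
      ultimately show ?thesis using r(2) place by blast
    qed
    moreover have "{cw s - 1, cw s, cw s + 1} \<subseteq> ?C" if s: "s < N * t" for s
    proof -
      have 1: "cu (s div t) * K + q \<in> ?C" if "q \<in> slot_blocks V cv t" for q
        using that cw_slot(1)[OF s] by blast
      have 2: "{cv (s mod t) - 1, cv (s mod t), cv (s mod t) + 1} \<subseteq> slot_blocks V cv t"
        using cw_slot(2)[OF s] unfolding slot_blocks_def by blast
      have "cw s - 1 = cu (s div t) * K + (cv (s mod t) - 1)" "cw s = cu (s div t) * K + cv (s mod t)"
        "cw s + 1 = cu (s div t) * K + (cv (s mod t) + 1)"
        using V.core_pos[OF cw_slot(2)[OF s]] by (simp_all add: cw_def)
      with 1[of "cv (s mod t) - 1"] 1[of "cv (s mod t)"] 1[of "cv (s mod t) + 1"] 2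
      show ?thesis by (metis insert_subset empty_subsetI)
    qed
    ultimately have "(fst \<circ> fst) ` W \<subseteq> ?C \<union> ?M" "(\<Union>s<N * t. {cw s - 1, cw s, cw s + 1}) \<subseteq> ?C \<union> ?M"
      by (fastforce, blast)
    then show ?thesis unfolding slot_blocks_def[of W] by (rule Un_least)
  qed
  then have "card (slot_blocks W cw (N * t)) \<le> card (?C \<union> ?M)"
    using finU finV by (intro card_mono) auto
  also have "\<dots> \<le> card ?C + card ?M" by (rule card_Un_le)
  also have "card ?M \<le> card (slot_blocks U cu N)" using finU by (rule card_image_le)
  also have "card ?C \<le> (\<Sum>i<N. card ((\<lambda>q. cu i * K + q) ` slot_blocks V cv t))"
    by (rule card_UN_le) simp
  also have "\<dots> \<le> (\<Sum>i<N. card (slot_blocks V cv t))"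
    using finV by (intro sum_mono card_image_le)
  finally show ?thesis by simp
qed

end

section \<open>Realizable parameters and the base sequence\<close>

definition realizable :: "nat \<Rightarrow> nat \<Rightarrow> nat \<Rightarrow> nat \<Rightarrow> nat \<Rightarrow> bool" where
  "realizable k n N L B \<longleftrightarrow>
    (\<exists>E c K. slotted E c K N n k \<and> L \<le> card (snd ` E) \<and> card (slot_blocks E c N) \<le> B)"

lemma realizable_compose:
  assumes "realizable k t N L B" "realizable (k + 2) n t L' B'" "1 \<le> t"
  shows "realizable (k + 2) (Suc n) (N * t) (L + N * L') (B + N * B')"
proof -
  obtain U cu KU where U: "slotted U cu KU N t k" "L \<le> card (snd ` U)" "card (slot_blocks U cu N) \<le> B"
    using assms(1) unfolding realizable_def by blast
  obtain V cv K where V: "slotted V cv K t n (k + 2)" "L' \<le> card (snd ` V)" "card (slot_blocks V cv t) \<le> B'"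
    using assms(2) unfolding realizable_def by blast
  interpret composition U cu KU N t k V cv K n
    using U(1) V(1) assms(3) by (simp add: composition_def composition_axioms_def)
  have "L + N * L' \<le> card (snd ` W)"
    using W_card_letters U(2) V(2) by (meson add_mono le_trans mult_le_mono2)
  moreover have "card (slot_blocks W cw (N * t)) \<le> B + N * B'"
    using W_card_blocks U(3) V(3) by (meson add_mono le_trans mult_le_mono2)
  ultimately show ?thesis using W_slotted unfolding realizable_def by blast
qed

lemma card_slots_le: "card (\<Union>i<N. {c i - 1, c i, c i + (1::nat)}) \<le> 3 * N"
proof -
  have "card (\<Union>i<N. {c i - 1, c i, c i + 1}) \<le> (\<Sum>i<N. card {c i - 1, c i, c i + 1})"
    by (rule card_UN_le) simp
  also have "\<dots> \<le> (\<Sum>i<N. 3)" by (rule sum_mono) (simp add: card_insert_if)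
  finally show ?thesis by simp
qed

text \<open>It starts each level at \<open>n = 0\<close>, and it serves as a host that puts disjoint
  copies side by side.\<close>

lemma realizable_empty: "realizable k n N 0 (3 * N)"
proof -
  have "slotted {} (\<lambda>i. 3 * i + 1) (3 * N) N n k"
    by unfold_locales (auto simp: five_free_def)
  moreover have "card (slot_blocks {} (\<lambda>i. 3 * i + 1) N) \<le> 3 * N"
    using card_slots_le[of "\<lambda>i. 3 * i + 1" N] by (simp add: slot_blocks_def)
  ultimately show ?thesis unfolding realizable_def by blast
qed

text \<open>
  The letter \<open>(i, j)\<close> starts in slot \<open>i\<close> and ends in slot \<open>j\<close>. Letters that share a slot are
  listed in opposite orders in its two blocks.
\<close>

definition base_occs :: "nat \<Rightarrow> nat \<Rightarrow> nat \<Rightarrow> (nat \<times> int) set" where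
  "base_occs t i j = {(3 * i + 1, int j - 1), (3 * i + 2, - int j), (3 * j, - 1 - int i), (3 * j + 1, int i - int t)}"

definition base_seq :: "nat \<Rightarrow> ((nat \<times> int) \<times> nat) set" where
  "base_seq t = {(p, prod_encode (i, j)) | p i j. i < j \<and> j \<le> t \<and> p \<in> base_occs t i j}"

lemma base_seq_iff: "(p, prod_encode (i, j)) \<in> base_seq t \<longleftrightarrow> i < j \<and> j \<le> t \<and> p \<in> base_occs t i j"
  by (cases p) (auto simp: base_seq_def)

lemma base_seqE:
  assumes "(p, x) \<in> base_seq t"
  obtains i j where "x = prod_encode (i, j)" "i < j" "j \<le> t" "p \<in> base_occs t i j"
  using assms by (auto simp: base_seq_def)

lemma base_occs_iff:
  "(b, r) \<in> base_occs t i j \<longleftrightarrow> (b mod 3 = 1 \<and> (b div 3 = i \<and> r = int j - 1 \<or> b div 3 = j \<and> r = int i - int t)) \<or>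
    (b mod 3 = 2 \<and> b div 3 = i \<and> r = - int j) \<or> (b mod 3 = 0 \<and> b div 3 = j \<and> r = - 1 - int i)"
proof -
  have "b = 3 * i + 1 \<longleftrightarrow> b mod 3 = 1 \<and> b div 3 = i" "b = 3 * j + 1 \<longleftrightarrow> b mod 3 = 1 \<and> b div 3 = j"
    "b = 3 * i + 2 \<longleftrightarrow> b mod 3 = 2 \<and> b div 3 = i" "b = 3 * j \<longleftrightarrow> b mod 3 = 0 \<and> b div 3 = j"
    by presburger+
  then show ?thesis unfolding base_occs_def by simp blast
qed

lemma base_occs_unique:
  assumes "p \<in> base_occs t i j" "i < j" "j \<le> t" "p \<in> base_occs t i' j'" "i' < j'" "j' \<le> t"
  shows "i = i' \<and> j = j'"
  using assms by (cases p) (auto simp: base_occs_iff)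

text \<open>\<open>p3\<close> is the second or the third occurrence of its letter. If it is the
  second, \<open>p2\<close> lies between the first two, so the other letter starts in the same slot
  and, by the opposite orders, has \<open>j < j'\<close>. Then it has no occurrence between
  \<open>p3\<close> and \<open>p5\<close>. The other case is the mirror image.\<close>

lemma base_occs_free:
  assumes ij: "i < j" "j \<le> t" and ij': "i' < j'" "j' \<le> t" and ne: "(i, j) \<noteq> (i', j')"
    and p: "p1 \<in> base_occs t i j" "p2 \<in> base_occs t i' j'" "p3 \<in> base_occs t i j"
      "p4 \<in> base_occs t i' j'" "p5 \<in> base_occs t i j"
    and lt: "p1 < p2" "p2 < p3" "p3 < p4" "p4 < p5"
  shows False
proof -
  have lt': "p1 < p3" "p3 < p5" using lt by (meson less_trans)+
  then have "p3 = (3 * i + 2, - int j) \<or> p3 = (3 * j, - 1 - int i)"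
    using p(1,3,5) ij by (auto simp: base_occs_def)
  then show False
  proof
    assume p3: "p3 = (3 * i + 2, - int j)"
    have "p1 = (3 * i + 1, int j - 1)" using p(1) p3 lt'(1) ij by (auto simp: base_occs_def)
    then have "i' = i \<and> j < j'"
      using p(2) lt(1,2) p3 ij ij' by (auto simp: base_occs_def; linarith)
    with p(4,5) p3 lt(3,4) ij ij' show False by (auto simp: base_occs_def)
  next
    assume p3: "p3 = (3 * j, - 1 - int i)"
    have "p5 = (3 * j + 1, int i - int t)" using p(5) p3 lt'(2) ij by (auto simp: base_occs_def)
    then have "j' = j \<and> i' < i"
      using p(4) lt(3,4) p3 ij ij' by (auto simp: base_occs_def; presburger)
    with p(1,2) p3 lt(1,2) ij ij' show False by (auto simp: base_occs_def)
  qed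
qed

lemma base_slotted: "slotted (base_seq t) (\<lambda>i. 3 * i + 1) (3 * (t + 1)) (t + 1) t 4"
proof
  have "base_seq t \<subseteq> (\<Union>i\<le>t. \<Union>j\<le>t. (\<lambda>p. (p, prod_encode (i, j))) ` base_occs t i j)"
  proof
    fix z assume "z \<in> base_seq t"
    then obtain p i j where "z = (p, prod_encode (i, j))" "i < j" "j \<le> t" "p \<in> base_occs t i j"
      unfolding base_seq_def by blast
    then show "z \<in> (\<Union>i\<le>t. \<Union>j\<le>t. (\<lambda>p. (p, prod_encode (i, j))) ` base_occs t i j)"
      by (intro UN_I[of i] UN_I[of j]) auto
  qed
  then show "finite (base_seq t)" by (rule finite_subset) (auto simp: base_occs_def)
  show "five_free (base_seq t)"
    unfolding five_free_def
  proof (intro notI, elim exE conjE)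
    fix p1 p2 p3 p4 p5 x y
    assume xy: "x \<noteq> y" and lt: "p1 < p2" "p2 < p3" "p3 < p4" "p4 < p5"
      and E: "(p1, x) \<in> base_seq t" "(p2, y) \<in> base_seq t" "(p3, x) \<in> base_seq t"
        "(p4, y) \<in> base_seq t" "(p5, x) \<in> base_seq t"
    obtain i j where x: "x = prod_encode (i, j)" using E(1) by (rule base_seqE)
    obtain i' j' where y: "y = prod_encode (i', j')" using E(2) by (rule base_seqE)
    note E = E[unfolded x y base_seq_iff]
    have "(i, j) \<noteq> (i', j')" using xy x y by auto
    then show False using base_occs_free[of i j t i' j' p1 p2 p3 p4 p5] E lt by blast
  qed
next
  fix p x y assume "(p, x) \<in> base_seq t" "(p, y) \<in> base_seq t"
  then show "x = y" by (auto elim!: base_seqE dest: base_occs_unique)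
next
  fix p x assume "(p, x) \<in> base_seq t"
  then obtain i j where x: "x = prod_encode (i, j)" and ij: "i < j" "j \<le> t" by (auto elim: base_seqE)
  show "\<exists>i<t + 1. \<exists>r\<ge>0. ((3 * i + 1, r), x) \<in> base_seq t"
    using ij by (intro exI[of _ i] conjI exI[of _ "int j - 1"]) (auto simp: x base_seq_iff base_occs_def)
  show "\<exists>i<t + 1. \<exists>r<0. ((3 * i + 1, r), x) \<in> base_seq t"
    using ij by (intro exI[of _ j] conjI exI[of _ "int i - int t"]) (auto simp: x base_seq_iff base_occs_def)
  have "{b. \<exists>r. ((b, r), x) \<in> base_seq t} = {3 * i + 1, 3 * i + 2, 3 * j, 3 * j + 1}"
    using ij by (auto simp: x base_seq_iff base_occs_def)
  then show "4 \<le> card {b. \<exists>r. ((b, r), x) \<in> base_seq t}" using ij by (auto simp: card_insert_if; presburger)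
next
  fix b r x i assume "((b, r), x) \<in> base_seq t" 
  then show "- int t \<le> r \<and> r < int t" by (auto elim!: base_seqE simp: base_occs_def)
next
  fix b r r' x assume "((b, r), x) \<in> base_seq t" "((b, r'), x) \<in> base_seq t"
  then show "r = r'" by (auto elim!: base_seqE simp: base_occs_iff)
next
  fix b r x assume "((b, r), x) \<in> base_seq t"
  then show "b < 3 * (t + 1)" by (auto elim!: base_seqE simp: base_occs_def)
next
  fix i r x b r' assume 1: "((3 * i + 1, r), x) \<in> base_seq t" and 2: "((b, r'), x) \<in> base_seq t"
  obtain i' j' where x: "x = prod_encode (i', j')" "i' < j'" "j' \<le> t" using 1 by (rule base_seqE)
  have b: "b = 3 * i' + 1 \<or> b = 3 * i' + 2 \<or> b = 3 * j' \<or> b = 3 * j' + 1"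
    using 2 by (auto simp: x(1) base_seq_iff base_occs_def)
  have "0 \<le> r \<and> i = i' \<or> r < 0 \<and> i = j'"
    using 1 x by (auto simp: x(1) base_seq_iff base_occs_iff)
  then show "0 \<le> r \<Longrightarrow> 3 * i + 1 \<le> b" "r < 0 \<Longrightarrow> b \<le> 3 * i + 1"
    using b x by auto
qed auto

lemma realizable_base: "\<exists>L. t * (t + 1) \<le> 2 * L \<and> realizable 4 t (t + 1) L (3 * (t + 1))"
proof -
  let ?S = "Sigma {..t} (\<lambda>j. {..<j})"
  let ?f = "\<lambda>(j, i). prod_encode (i, j)"
  have "?f ` ?S \<subseteq> snd ` base_seq t"
  proof (intro image_subsetI, clarify)
    fix j i assume "j \<le> t" "i < j"
    then have "((3 * i + 1, int j - 1), prod_encode (i, j)) \<in> base_seq t"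
      by (simp add: base_seq_iff base_occs_def)
    then show "prod_encode (i, j) \<in> snd ` base_seq t" by (rule rev_image_eqI) simp
  qed
  moreover interpret slotted "base_seq t" "\<lambda>i. 3 * i + 1" "3 * (t + 1)" "t + 1" t 4
    by (rule base_slotted)
  have "card (?f ` ?S) = card ?S" by (rule card_image) (auto simp: inj_on_def)
  moreover have "2 * card ?S = t * (t + 1)"
    by (induction t) (auto simp: card_SigmaI)
  ultimately have "t * (t + 1) \<le> 2 * card (snd ` base_seq t)"
    using card_mono[of "snd ` base_seq t" "?f ` ?S"] fin by simp
  moreover have "slot_blocks (base_seq t) (\<lambda>i. 3 * i + 1) (t + 1) \<subseteq> {..<3 * (t + 1)}"
    by (auto simp: slot_blocks_def dest: block_less)
  then have "card (slot_blocks (base_seq t) (\<lambda>i. 3 * i + 1) (t + 1)) \<le> 3 * (t + 1)"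
    using card_mono[of "{..<3 * (t + 1)}"] by fastforce
  ultimately show ?thesis using base_slotted unfolding realizable_def by blast
qed

text \<open>
  \<open>slots e n\<close> is the number of slots of the \<open>n\<close>-th sequence with \<open>2 e + 4\<close> occurrences per letter; in
  terms of the theorem, \<open>e = d - 1\<close>.
\<close>

fun slots :: "nat \<Rightarrow> nat \<Rightarrow> nat" where
  "slots 0 t = t + 1"
| "slots (Suc e) 0 = 1"
| "slots (Suc e) (Suc n) = slots e (slots (Suc e) n) * slots (Suc e) n"

lemma slots_ge_2: "1 \<le> t \<Longrightarrow> 2 \<le> slots e t" and slots_pos: "1 \<le> slots e t"
proof (induction e t rule: slots.induct)
  case (3 e n)
  { case 1 
    have "2 * 1 \<le> slots e (slots (Suc e) n) * slots (Suc e) n" using 3 by (intro mult_le_mono) auto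
    then show ?case by simp
  next
    case 2
    have "2 * 1 \<le> slots e (slots (Suc e) n) * slots (Suc e) n" using 3 by (intro mult_le_mono) auto
    then have "1 \<le> slots e (slots (Suc e) n) * slots (Suc e) n" by linarith
    then show ?case by (simp only: slots.simps) }
qed auto

lemma realizable_slots:
  "\<exists>c. \<forall>n. \<exists>L. n * slots e n \<le> 2 * L \<and> realizable (2 * e + 4) n (slots e n) L (c * slots e n)"
proof (induction e)
  case 0
  show ?case using realizable_base by (intro exI[of _ 3]) (simp add: mult.commute)
next
  case (Suc e)
  then obtain c where c: "\<And>n. \<exists>L. n * slots e n \<le> 2 * L \<and> realizable (2 * e + 4) n (slots e n) L (c * slots e n)"
    by blast
  \<comment> \<open>The number of blocks per slot grows by at most \<open>c / slots (Suc e) n\<close> in step \<open>n\<close>. The summand \<open>2 * c\<close>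
    makes the induction absorb this convergent sum.\<close>
  have "\<exists>L B. n * slots (Suc e) n \<le> 2 * L \<and> B + 2 * c \<le> (3 + 2 * c) * slots (Suc e) n \<and>
    realizable (2 * e + 4 + 2) n (slots (Suc e) n) L B" for n
  proof (induction n)
    case 0
    show ?case using realizable_empty[of _ _ 1] by (intro exI[of _ 0] exI[of _ 3]) auto
  next
    case (Suc n)
    then obtain L' B' where V: "n * slots (Suc e) n \<le> 2 * L'" "B' + 2 * c \<le> (3 + 2 * c) * slots (Suc e) n"
      "realizable (2 * e + 4 + 2) n (slots (Suc e) n) L' B'" by blast
    define t N where "t = slots (Suc e) n" and "N = slots e t"
    obtain L where U: "t * N \<le> 2 * L" "realizable (2 * e + 4) t N L (c * N)" using c[of t] by (auto simp: N_def)
    have "1 \<le> t" unfolding t_def by (rule slots_pos)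
    then have "2 \<le> N" unfolding N_def by (rule slots_ge_2)
    have R: "realizable (2 * e + 4 + 2) (Suc n) (N * t) (L + N * L') (c * N + N * B')"
      by (rule realizable_compose) (use U V \<open>1 \<le> t\<close> in \<open>auto simp: t_def\<close>)
    have sl: "slots (Suc e) (Suc n) = N * t" by (simp add: N_def t_def)
    \<comment> \<open>\<open>U\<close> has at least \<open>t / 2\<close> letters per slot of its
      own, hence \<open>1 / 2\<close> per slot of the composition; the copies keep their
      \<open>n / 2\<close>.\<close>
    have "Suc n * (N * t) = t * N + N * (n * t)" by (simp add: algebra_simps)
    also have "\<dots> \<le> 2 * L + N * (2 * L')" using U V by (intro add_mono mult_le_mono2) (auto simp: t_def)
    finally have 1: "Suc n * (N * t) \<le> 2 * (L + N * L')" by (simp add: algebra_simps)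
    have "c * N + N * B' + 2 * c \<le> c * N + N * B' + N * c" using \<open>2 \<le> N\<close> by simp
    also have "\<dots> = N * (B' + 2 * c)" by (simp add: algebra_simps)
    also have "\<dots> \<le> N * ((3 + 2 * c) * t)" using V by (intro mult_le_mono2) (auto simp: t_def)
    finally have 2: "c * N + N * B' + 2 * c \<le> (3 + 2 * c) * (N * t)" by (simp add: algebra_simps)
    show ?case using R 1 2 unfolding sl by blast
  qed
  moreover have "realizable k n N L B'" if "realizable k n N L B" "B \<le> B'" for k n N L B B'
    using that unfolding realizable_def by (meson le_trans)
  ultimately have "\<exists>L. n * slots (Suc e) n \<le> 2 * L \<and>
    realizable (2 * Suc e + 4) n (slots (Suc e) n) L ((3 + 2 * c) * slots (Suc e) n)" for n
    by (metis add.commute add.left_commute le_add1 le_trans mult_Suc_right)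
  then show ?case by blast
qed

section \<open>From sets of positions to sequences on blocks\<close>

lemma concat_filter_sorted:
  assumes "sorted (map f xs)" "sorted bs" "distinct bs" "f ` set xs \<subseteq> set bs"
  shows "concat (map (\<lambda>b. filter (\<lambda>x. f x = b) xs) bs) = xs"
  using assms
proof (induction bs arbitrary: xs)
  case (Cons b bs)
  have split: "filter (\<lambda>x. f x = b) xs @ filter (\<lambda>x. f x \<noteq> b) xs = xs"
    using Cons.prems(1,2,4)
  proof (induction xs)
    case (Cons x xs)
    show ?case
    proof (cases "f x = b")
      case False
      then have "b < f x" using Cons.prems by force
      then have "filter (\<lambda>x. f x = b) xs = []" using Cons.prems by (fastforce simp: filter_empty_conv)
      with False show ?thesis using Cons by auto
    qed (use Cons in auto)
  qed simp
  let ?ys = "filter (\<lambda>x. f x \<noteq> b) xs"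
  have "concat (map (\<lambda>b. filter (\<lambda>x. f x = b) ?ys) bs) = ?ys"
    using Cons.prems by (intro Cons.IH) (auto simp: sorted_filter)
  moreover have "map (\<lambda>b'. filter (\<lambda>x. f x = b') ?ys) bs = map (\<lambda>b'. filter (\<lambda>x. f x = b') xs) bs"
    using Cons.prems(3) by (auto simp: intro!: filter_cong)
  ultimately have "concat (map (\<lambda>b. filter (\<lambda>x. f x = b) xs) bs) = ?ys" by (simp only:)
  then show ?case using split by simp
qed auto

lemma sorted_wrt_subseq: "subseq ys xs \<Longrightarrow> sorted_wrt P xs \<Longrightarrow> sorted_wrt P ys"
  by (induction rule: list_emb.induct) (auto dest: list_emb_set)

text \<open>\<open>E\<close> is read in increasing order of positions; positions with equal first
  coordinate form a block, and empty blocks fill up to \<open>m\<close>.\<close>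

lemma realizable_admissible:
  assumes "realizable k n N L B" "B \<le> m"
  shows "\<exists>u :: nat list. admissible 5 k m u \<and> L \<le> card (set u)"
proof -
  obtain E c K where E: "slotted E c K N n k" "L \<le> card (snd ` E)" "card (slot_blocks E c N) \<le> B"
    using assms unfolding realizable_def by blast
  interpret slotted E c K N n k by (fact E(1))
  define P where "P = fst ` E"
  define lab where "lab p = (THE x. (p, x) \<in> E)" for p
  have lab: "lab p = x" if "(p, x) \<in> E" for p x
    unfolding lab_def using that letter_unique by blast
  have labE: "(p, lab p) \<in> E" if "p \<in> P" for p
    using that lab unfolding P_def by (metis imageE prod.collapse)
  define ps where "ps = sorted_list_of_set P"
  have finP: "finite P" using fin unfolding P_def by (rule finite_imageI)
  then have ps: "set ps = P" "distinct ps" "sorted_wrt (<) ps"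
    unfolding ps_def by simp_all
  define u where "u = map lab ps"
  have setu: "set u = snd ` E"
  proof -
    have "lab ` P = snd ` E"
    proof (intro equalityI image_subsetI)
      fix p assume "p \<in> P" from labE[OF this] show "lab p \<in> snd ` E" by (rule rev_image_eqI) simp
    next
      fix z assume "z \<in> E"
      then show "snd z \<in> lab ` P" using lab[of "fst z" "snd z"] unfolding P_def by force
    qed
    then show ?thesis by (simp add: u_def ps)
  qed
  define bs where "bs = sorted_list_of_set (fst ` P)"
  define uss where "uss = map (\<lambda>b. map lab (filter (\<lambda>p. fst p = b) ps)) bs"
  have "sorted (map fst ps)" using ps(3) unfolding sorted_map
    by (rule sorted_wrt_mono_rel[rotated]) (auto simp: less_prod_def)
  then have blocks: "concat (map (\<lambda>b. filter (\<lambda>p. fst p = b) ps) bs) = ps"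
    by (rule concat_filter_sorted) (use ps finP in \<open>auto simp: bs_def\<close>)
  have "map lab (concat (map (\<lambda>b. filter (\<lambda>p. fst p = b) ps) bs)) = concat uss"
    by (simp add: uss_def map_concat comp_def)
  then have u: "u = concat uss" by (simp add: u_def blocks)
  have "length uss \<le> m"
  proof -
    have "length uss = card (fst ` P)" by (simp add: uss_def bs_def)
    also have "\<dots> \<le> card (slot_blocks E c N)"
      using fin by (intro card_mono) (auto simp: slot_blocks_def P_def image_image)
    finally show ?thesis using E(3) assms(2) by simp
  qed
  have "distinct b" if bu: "b \<in> set uss" for b
  proof -
    obtain B where b: "b = map lab (filter (\<lambda>p. fst p = B) ps)" using bu by (auto simp: uss_def)
    have "inj_on lab {p \<in> P. fst p = B}"
    proof (rule inj_onI)
      fix p q assume p: "p \<in> {p \<in> P. fst p = B}" and q: "q \<in> {p \<in> P. fst p = B}" and "lab p = lab q"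
      moreover obtain r r' where "p = (B, r)" "q = (B, r')" using p q by (metis (mono_tags) mem_Collect_eq prod.collapse)
      ultimately show "p = q" using labE[of p] labE[of q] rank_unique[of B r "lab q" r'] by auto
    qed
    then show ?thesis using ps by (auto simp: b distinct_map)
  qed
  then have "on_blocks m u"
    unfolding on_blocks_def is_block_def using u \<open>length uss \<le> m\<close>
    by (intro exI[of _ "uss @ replicate (m - length uss) []"]) auto
  moreover have "avoids_alternations 5 u"
    unfolding avoids_alternations_def
  proof
    assume "\<exists>w. subseq w u \<and> is_alternation 5 w"
    then obtain a b where ab: "a \<noteq> b" "subseq (map (\<lambda>i. if even i then a else b) [0..<5]) u"
      by (auto simp: is_alternation_def)
    have five: "[0..<5] = [0, 1, 2, 3, 4::nat]" by (simp add: upt_rec)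
    have "subseq [a, b, a, b, a] (map lab ps)" using ab(2) by (simp add: five u_def)
    \<comment> \<open>The index set of the alternation lifts it from letters to positions.\<close>
    then obtain M where "[a, b, a, b, a] = nths (map lab ps) M" unfolding subseq_conv_nths by blast
    then have "map lab (nths ps M) = [a, b, a, b, a]" by (simp only: nths_map)
    then obtain qs where qs: "subseq qs ps" "map lab qs = [a, b, a, b, a]"
      by (metis subseq_conv_nths)
    then obtain p1 p2 p3 p4 p5 where q: "qs = [p1, p2, p3, p4, p5]" by (auto simp: map_eq_Cons_conv)
    have "sorted_wrt (<) qs" using qs(1) ps(3) by (rule sorted_wrt_subseq)
    then have lt: "p1 < p2" "p2 < p3" "p3 < p4" "p4 < p5" by (simp_all add: q)
    have "set qs \<subseteq> P"
    proof
      fix p assume "p \<in> set qs"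
      with qs(1) show "p \<in> P" unfolding ps(1)[symmetric] by (auto elim: list_emb_set)
    qed
    then have "p1 \<in> P" "p2 \<in> P" "p3 \<in> P" "p4 \<in> P" "p5 \<in> P" by (simp_all add: q)
    note this[THEN labE]
    moreover have "lab p1 = a" "lab p2 = b" "lab p3 = a" "lab p4 = b" "lab p5 = a"
      using qs(2) by (simp_all add: q)
    ultimately have "(p1, a) \<in> E" "(p2, b) \<in> E" "(p3, a) \<in> E" "(p4, b) \<in> E" "(p5, a) \<in> E"
      by simp_all
    then show False using free lt ab(1) unfolding five_free_def by blast
  qed
  moreover have "k \<le> count_list u x" if x: "x \<in> set u" for x
  proof -
    obtain p where p: "(p, x) \<in> E" using x setu by auto
    have "count_list u x = length (filter (\<lambda>p. lab p = x) ps)"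
      by (simp add: u_def count_list_eq_length_filter filter_map comp_def eq_commute)
    also have "\<dots> = card {p \<in> P. lab p = x}"
      using ps by (simp add: distinct_length_filter Int_def conj_commute)
    finally have "count_list u x = card {p \<in> P. lab p = x}" .
    moreover have "card {b. \<exists>r. ((b, r), x) \<in> E} \<le> card {p \<in> P. lab p = x}"
    proof -
      have "{b. \<exists>r. ((b, r), x) \<in> E} \<subseteq> fst ` {p \<in> P. lab p = x}"
      proof
        fix b assume "b \<in> {b. \<exists>r. ((b, r), x) \<in> E}"
        then obtain r where r: "((b, r), x) \<in> E" by auto
        then have "(b, r) \<in> P" unfolding P_def by (rule rev_image_eqI) simp
        with lab[OF r] show "b \<in> fst ` {p \<in> P. lab p = x}" by (intro rev_image_eqI[of "(b, r)"]) auto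
      qed
      then have "card {b. \<exists>r. ((b, r), x) \<in> E} \<le> card (fst ` {p \<in> P. lab p = x})"
        using finP by (intro card_mono) auto
      also have "\<dots> \<le> card {p \<in> P. lab p = x}" using finP by (intro card_image_le) auto
      finally show ?thesis .
    qed
    ultimately show ?thesis using enough[OF p] by simp
  qed
  ultimately have "admissible 5 k m u" unfolding admissible_def by blast
  then show ?thesis using E(2) setu by auto
qed

text \<open>An empty host with \<open>q\<close> slots holds \<open>q\<close> disjoint copies. It
  brings \<open>3 * q\<close> blocks of its own, so the constant is the number of blocks per slot
  plus 3.\<close>

lemma many_letters:
  "\<exists>c\<ge>1. \<forall>n q m. q * c * slots e n \<le> m \<longrightarrow>
    (\<exists>u :: nat list. admissible 5 (2 * e + 4) m u \<and> q * n * slots e n \<le> 2 * card (set u))"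
proof -
  obtain c where c: "\<And>n. \<exists>L. n * slots e n \<le> 2 * L \<and> realizable (2 * e + 4) n (slots e n) L (c * slots e n)"
    using realizable_slots[of e] by blast
  have "\<exists>u :: nat list. admissible 5 (2 * e + 4) m u \<and> q * n * slots e n \<le> 2 * card (set u)"
    if m: "q * (c + 3) * slots e n \<le> m" for n q m
  proof -
    obtain L where L: "n * slots e n \<le> 2 * L" "realizable (2 * e + 2 + 2) n (slots e n) L (c * slots e n)"
      using c[of n] by (auto simp: numeral_eq_Suc)
    have "realizable (2 * e + 2 + 2) (Suc n) (q * slots e n) (0 + q * L) (3 * q + q * (c * slots e n))"
      by (rule realizable_compose[OF realizable_empty L(2) slots_pos])
    moreover have "3 * q + q * (c * slots e n) \<le> m"
    proof -
      have "3 * q * 1 \<le> 3 * q * slots e n" using slots_pos by (rule mult_le_mono2)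
      moreover have "q * (c + 3) * slots e n = 3 * q * slots e n + q * (c * slots e n)"
        by (simp add: algebra_simps)
      ultimately show ?thesis using m by linarith
    qed
    ultimately obtain u :: "nat list" where "admissible 5 (2 * e + 4) m u" "q * L \<le> card (set u)"
      using realizable_admissible by (fastforce simp: numeral_eq_Suc)
    moreover have "q * n * slots e n \<le> q * (2 * L)" using L(1) by (simp add: mult.assoc)
    moreover have "q * (2 * L) = 2 * (q * L)" by simp
    ultimately show ?thesis by (intro exI[of _ u]) linarith
  qed
  then show ?thesis by (intro exI[of _ "c + 3"]) auto
qed

section \<open>Asymptotics\<close>

lemma cuttable_anti_mono: "cuttable k m Q \<Longrightarrow> k \<le> k' \<Longrightarrow> cuttable k' m Q"
  unfolding cuttable_def by (meson le_trans)

text \<open>It makes the \<open>Max\<close> in \<open>max_letters\<close> a true maximum; four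
  occurrences per letter already give a quadratic bound.\<close>

lemma finite_letter_counts:
  assumes "4 \<le> k"
  shows "finite {card (set u) | u :: nat list. admissible 5 k m u}"
proof (rule finite_subset)
  have "cuttable k m (m * m)" using cuttable_4 assms by (rule cuttable_anti_mono)
  then show "{card (set u) | u :: nat list. admissible 5 k m u} \<subseteq> {..m * m}"
    using admissible_card_le by auto
qed simp

lemma max_letters_ge:
  fixes u :: "nat list"
  assumes "4 \<le> k" "admissible 5 k m u"
  shows "card (set u) \<le> max_letters 5 k m"
  unfolding max_letters_def using finite_letter_counts[OF assms(1)] assms(2) by (intro Max_ge) auto

lemma max_letters_le:
  assumes "4 \<le> k" "cuttable k m Q"
  shows "max_letters 5 k m \<le> Q"
proof -
  have "admissible 5 k m ([] :: nat list)"
    unfolding admissible_def on_blocks_def is_block_def avoids_alternations_def is_alternation_def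
    by (auto intro!: exI[of _ "replicate m []"])
  then have "{card (set u) | u :: nat list. admissible 5 k m u} \<noteq> {}" by blast
  then show ?thesis unfolding max_letters_def
    using finite_letter_counts[OF assms(1)] admissible_card_le[OF _ assms(2)] by (subst Max_le_iff) auto
qed

section \<open>Growth of the hierarchy and of the slot numbers\<close>

lemma Suc_le_power_2: "Suc n \<le> 2 ^ n"
  using less_exp[of n] by (simp only: Suc_le_eq)

text \<open>The two facts feed each other: doubling at a level gives its power bound, and the power
  bound gives doubling one level up, since \<open>2 * x \<le> 2 ^ x\<close> for positive
  \<open>x\<close>.\<close>

lemma ack_hier_double: "2 \<le> d \<Longrightarrow> 2 * ack_hier d n \<le> ack_hier d (Suc n)"
  and ack_hier_ge_power: "2 \<le> d \<Longrightarrow> 2 ^ n \<le> ack_hier d n"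
proof -
  have power: "2 ^ n \<le> ack_hier d n" if "\<And>n. 2 * ack_hier d n \<le> ack_hier d (Suc n)" "2 \<le> d" for d n
  proof (induction n)
    case 0
    then show ?case using ack_hier_ge_1[OF that(2)] by simp
  next
    case (Suc n)
    then show ?case using that(1)[of n] by simp
  qed
  have double: "2 * ack_hier d n \<le> ack_hier d (Suc n)" if "2 \<le> d" for d n
    using that
  proof (induction d arbitrary: n rule: dec_induct)
    case base
    then show ?case by (simp add: ack_hier_2)
  next
    case (step d)
    let ?x = "ack_hier (Suc d) n"
    have "1 \<le> ?x" using step by (intro ack_hier_ge_1) auto
    then obtain y where y: "?x = Suc y" by (cases ?x) auto
    have "2 * ?x \<le> 2 * 2 ^ y" using Suc_le_power_2[of y] y by simp
    also have "\<dots> = 2 ^ ?x" by (simp add: y)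
    also have "\<dots> \<le> ack_hier d ?x" using power step by auto
    also have "\<dots> = ack_hier (Suc d) (Suc n)" using step by (cases d) auto
    finally show ?case .
  qed
  show "2 \<le> d \<Longrightarrow> 2 * ack_hier d n \<le> ack_hier d (Suc n)" by (rule double)
  show "2 \<le> d \<Longrightarrow> 2 ^ n \<le> ack_hier d n" by (rule power[OF double])
qed

lemma ack_hier_mono:
  assumes "2 \<le> d" "x \<le> y" shows "ack_hier d x \<le> ack_hier d y"
proof (rule lift_Suc_mono_le[OF _ assms(2)])
  show "ack_hier d n \<le> ack_hier d (Suc n)" for n using ack_hier_double[OF assms(1), of n] by simp
qed

text \<open>A constant factor becomes a shift of the argument, so it changes the inverse by at most
  a constant.\<close>

lemma ack_hier_add:
  assumes "2 \<le> d" shows "2 ^ y * ack_hier d x \<le> ack_hier d (x + y)"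
proof (induction y)
  case (Suc y)
  then show ?case using ack_hier_double[OF assms, of "x + y"] by simp
qed simp

lemma ack_hier_ge_double: 
  assumes "2 \<le> d" "1 \<le> x" shows "2 * x \<le> ack_hier d x"
proof -
  obtain y where y: "x = Suc y" using assms by (cases x) auto
  have "2 * x \<le> 2 ^ x" using Suc_le_power_2[of y] y by simp
  also have "\<dots> \<le> ack_hier d x" by (rule ack_hier_ge_power[OF assms(1)])
  finally show ?thesis .
qed

lemma ack_hier_inv_ack:
  assumes "2 \<le> d" shows "m \<le> ack_hier d (inv_ack d m)"
proof -
  have "m \<le> ack_hier d m" using ack_hier_ge_power[OF assms, of m] less_exp[of m] by linarith
  then show ?thesis unfolding inv_ack_def by (rule LeastI)
qed

text \<open>A step takes s to s (s + 1), which is at most 2 s^2; with the factor 2 in front this is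
  at most squaring.\<close>

lemma slots_1_le: "2 * slots 1 n \<le> 2 ^ 2 ^ n"
proof (induction n)
  case (Suc n)
  have "1 \<le> slots 1 n" by (rule slots_pos)
  then have "2 * slots 1 (Suc n) \<le> (2 * slots 1 n) * (2 * slots 1 n)" by (simp add: algebra_simps)
  also have "\<dots> \<le> 2 ^ 2 ^ n * 2 ^ 2 ^ n" using Suc by (intro mult_le_mono)
  also have "\<dots> = 2 ^ 2 ^ Suc n" by (simp add: mult_2 power_add)
  finally show ?case .
qed simp

text \<open>One step of \<open>slots\<close> costs three steps of the hierarchy, whence the factor
  3: the value S is followed by at most \<open>2 ^ 2 ^ 2 ^ S\<close> at the start and by at most
  \<open>?A (?A (?A S))\<close> later. For \<open>e = 1\<close> this fails, as doubly exponential
  growth exceeds \<open>2 ^ (3 * n)\<close>.\<close>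

lemma slots_le_ack_hier: "2 \<le> e \<Longrightarrow> slots e n \<le> ack_hier (Suc e) (3 * n)"
proof (induction e arbitrary: n rule: dec_induct)
  case base
  show ?case
  proof (induction n)
    case (Suc n)
    let ?S = "slots 2 n"
    have S: "?S < 2 ^ ?S" by (rule less_exp)
    have "slots 2 (Suc n) = slots 1 ?S * ?S" by (simp add: numeral_2_eq_2)
    also have "\<dots> \<le> 2 ^ 2 ^ ?S * 2 ^ 2 ^ ?S"
    proof (rule mult_le_mono)
      show "slots 1 ?S \<le> 2 ^ 2 ^ ?S" using slots_1_le[of ?S] by linarith
      show "?S \<le> 2 ^ 2 ^ ?S" using S less_exp[of "2 ^ ?S"] by linarith
    qed
    also have "\<dots> = 2 ^ 2 ^ Suc ?S" by (simp add: mult_2 power_add)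
    also have "\<dots> \<le> 2 ^ 2 ^ 2 ^ ?S" using Suc_le_power_2 by (intro power_increasing) auto
    also have "\<dots> \<le> 2 ^ 2 ^ 2 ^ ack_hier 3 (3 * n)" using Suc
      by (intro power_increasing) (auto simp: numeral_3_eq_3 numeral_2_eq_2)
    also have "\<dots> = ack_hier 3 (3 * n + 3)"
    proof -
      have "ack_hier (Suc (Suc 0)) x = 2 ^ x" for x by (metis ack_hier_2 numeral_2_eq_2)
      then have ack_3: "ack_hier 3 (Suc x) = 2 ^ ack_hier 3 x" for x by (simp add: numeral_3_eq_3)
      have "3 * n + 3 = Suc (Suc (Suc (3 * n)))" by simp
      then show ?thesis by (simp only: ack_3)
    qed
    finally show ?case by (simp add: numeral_3_eq_3 numeral_2_eq_2)
  qed (simp add: numeral_2_eq_2)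
next
  case (step e)
  let ?A = "ack_hier (Suc e)"
  have d: "2 \<le> Suc e" using step by simp
  show ?case
  proof (induction n)
    case (Suc n)
    let ?S = "slots (Suc e) n"
    have pos: "1 \<le> ?S" by (rule slots_pos)
    have "slots (Suc e) (Suc n) \<le> ?A (3 * ?S) * 2 ^ ?S"
      using step.IH[of ?S] less_exp[of ?S] by (simp del: ack_hier.simps add: mult_le_mono)
    also have "\<dots> \<le> ?A (3 * ?S + ?S)" using ack_hier_add[OF d, of ?S "3 * ?S"] by (simp only: mult.commute)
    also have "\<dots> \<le> ?A (?A (?A ?S))"
    proof (rule ack_hier_mono[OF d])
      have "4 * ?S \<le> 2 * ?A ?S" using ack_hier_ge_double[OF d pos] by linarith
      also have "\<dots> \<le> ?A (?A ?S)" by (rule ack_hier_ge_double[OF d ack_hier_ge_1[OF d]])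
      finally show "3 * ?S + ?S \<le> ?A (?A ?S)" by linarith
    qed
    also have "\<dots> \<le> ?A (?A (?A (ack_hier (Suc (Suc e)) (3 * n))))"
      using Suc by (intro ack_hier_mono[OF d])
    also have "\<dots> = ack_hier (Suc (Suc e)) (3 * Suc n)" by (simp add: numeral_3_eq_3)
    finally show ?case .
  qed simp
qed

lemma slots_unbounded: "1 \<le> e \<Longrightarrow> n < slots e n"
proof -
  assume "1 \<le> e"
  then obtain e' where e: "e = Suc e'" by (cases e) auto
  have "2 ^ n \<le> slots e n"
  proof (induction n)
    case (Suc n)
    have "2 * 2 ^ n \<le> slots e' (slots e n) * slots e n"
      using Suc slots_ge_2[OF slots_pos] by (intro mult_le_mono) auto
    then show ?case by (simp add: e)
  qed (simp add: e)
  with less_exp[of n] show ?thesis by linarith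
qed

section \<open>From slot numbers to asymptotic bounds\<close>

text \<open>Take the largest \<open>n\<close> whose sequence fits into \<open>m\<close> blocks and
  as many copies of it as fit; they account for at least half of the blocks. Maximality bounds
  \<open>m\<close> from above, and each growth estimate turns this into a lower bound on
  \<open>n\<close>.\<close>

lemma max_letters_lower:
  assumes e: "1 \<le> e"
  shows "\<exists>c. \<forall>m\<ge>c * slots e 1. \<exists>n\<ge>1. m * n \<le> 4 * c * max_letters 5 (2 * e + 4) m \<and> m < c * slots e (Suc n)"
proof -
  obtain c where c: "c \<ge> 1" "\<And>n q m. q * c * slots e n \<le> m \<Longrightarrow>
    \<exists>u :: nat list. admissible 5 (2 * e + 4) m u \<and> q * n * slots e n \<le> 2 * card (set u)"
    using many_letters[of e] by blast
  have "\<exists>n\<ge>1. m * n \<le> 4 * c * max_letters 5 (2 * e + 4) m \<and> m < c * slots e (Suc n)"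
    if m: "c * slots e 1 \<le> m" for m
  proof -
    have ex: "m < c * slots e m"
      using slots_unbounded[OF e, of m] mult_le_mono1[OF c(1), of "slots e m"] by linarith
    define l where "l = (LEAST n. m < c * slots e n)"
    have l: "m < c * slots e l" unfolding l_def using ex by (rule LeastI)
    have "slots e 0 = 1" using e by (cases e) auto
    then have "slots e 0 \<le> slots e 1" using slots_pos[of e 1] by simp
    then have "c * slots e 0 \<le> m" using m mult_le_mono2 le_trans by blast
    then have "l \<noteq> 0" "l \<noteq> 1" using l m by (metis not_less)+
    then obtain n where n: "l = Suc n" "1 \<le> n" by (cases l) auto
    have "c * slots e n \<le> m" using not_less_Least[of n "\<lambda>n. m < c * slots e n"] n(1) unfolding l_def by simp
    define b where "b = c * slots e n"
    have b: "1 \<le> b" "b \<le> m" using c(1) slots_pos[of e n] \<open>c * slots e n \<le> m\<close> by (auto simp: b_def Suc_le_eq)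
    define q where "q = m div b"
    have q: "1 \<le> q" "q * b \<le> m" "m < q * b + b"
      using b dividend_less_div_times[of b m]
      by (simp_all add: q_def Suc_le_eq div_greater_zero_iff add.commute)
    obtain u :: "nat list" where u: "admissible 5 (2 * e + 4) m u" "q * n * slots e n \<le> 2 * card (set u)"
      using c(2)[of q n m] q(2) by (auto simp: b_def mult.assoc)
    have "m \<le> 2 * (q * b)" using q(3) mult_le_mono1[OF q(1), of b] by linarith
    then have "m * n \<le> 2 * (q * b) * n" by (rule mult_le_mono1)
    also have "\<dots> = 2 * c * (q * n * slots e n)" by (simp add: b_def mult_ac)
    also have "\<dots> \<le> 2 * c * (2 * card (set u))" using u(2) by (rule mult_le_mono2)
    also have "\<dots> \<le> 2 * c * (2 * max_letters 5 (2 * e + 4) m)"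
      using max_letters_ge[OF _ u(1)] by (intro mult_le_mono2) simp
    finally have "m * n \<le> 4 * c * max_letters 5 (2 * e + 4) m" by simp
    with n l show ?thesis by auto
  qed
  then show ?thesis by blast
qed

lemma exp_of_nat_mult_ln_2: "exp (real k * ln 2) = 2 ^ k"
  by (simp add: exp_of_nat_mult)

lemma max_letters_6_upper: "(\<lambda>m. real (max_letters 5 6 m)) \<in> O(\<lambda>m. real m * ln (ln (real m)))"
proof (rule bigoI[of _ 20], rule eventually_mono[OF eventually_ge_at_top[of "nat \<lceil>exp (exp 1 :: real)\<rceil>"]])
  \<comment> \<open>The threshold makes the double logarithm at least 1, so that it absorbs additive
    constants.\<close>
  fix m :: nat assume "nat \<lceil>exp (exp 1 :: real)\<rceil> \<le> m"
  then have m: "exp (exp 1) \<le> real m" by linarith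
  then have pos: "0 < real m" by (meson exp_gt_zero less_le_trans)
  have lnm: "exp 1 \<le> ln (real m)" using m pos by (subst ln_ge_iff) auto
  then have lnpos: "0 < ln (real m)" by (meson exp_gt_zero less_le_trans)
  let ?l = "ln (ln (real m))"
  have l: "1 \<le> ?l" using lnm lnpos by (subst ln_ge_iff) auto
  \<comment> \<open>As \<open>ln 2\<close> is at least 1/2, this \<open>j\<close> gives
    \<open>ln (real m) \<le> 2 ^ j\<close>; one more power of 2 pays for the change from base e to
    base 2.\<close>
  define j where "j = nat \<lceil>2 * ?l\<rceil>"
  have j: "2 * ?l \<le> real j" "real j \<le> 2 * ?l + 1" using l by (auto simp: j_def)
  have ln2: "1 / 2 \<le> ln (2 :: real)" using exp_bound_half[of "1 / 2 :: real"] by (subst ln_ge_iff) auto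
  have "real j * (1 / 2) \<le> real j * ln 2" using ln2 by (intro mult_left_mono) auto
  then have "exp ?l \<le> exp (real j * ln 2)" using j(1) by simp
  then have "ln (real m) \<le> 2 ^ j" using lnpos by (simp add: exp_of_nat_mult_ln_2)
  also have "\<dots> = 2 ^ Suc j * (1 / 2)" by simp
  also have "\<dots> \<le> 2 ^ Suc j * ln 2" using ln2 by (intro mult_left_mono) auto
  also have "\<dots> = real (2 ^ Suc j) * ln 2" by simp
  finally have "exp (ln (real m)) \<le> exp (real (2 ^ Suc j) * ln 2)" by (simp only: exp_le_cancel_iff)
  then have "real m \<le> 2 ^ 2 ^ Suc j" using pos unfolding exp_of_nat_mult_ln_2 by simp
  then have "real m \<le> real (2 ^ 2 ^ Suc j)" by simp
  then have "m \<le> 2 ^ 2 ^ Suc j" by (simp only: of_nat_le_iff)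
  then have "cuttable 6 m (5 * m * Suc j)" using cut_bound_6[unfolded cut_bound_def] by blast
  then have "max_letters 5 6 m \<le> 5 * m * Suc j" by (intro max_letters_le) auto
  then have "real (max_letters 5 6 m) \<le> real (5 * m * Suc j)" by (simp only: of_nat_le_iff)
  also have "\<dots> = 5 * real m * real (Suc j)" by (simp only: of_nat_mult of_nat_numeral)
  also have "\<dots> \<le> 5 * real m * (4 * ?l)" using j(2) l by (intro mult_left_mono) auto
  finally show "norm (real (max_letters 5 6 m)) \<le> 20 * norm (real m * ?l)"
    using l by (simp add: abs_mult)
qed

lemma max_letters_6_lower: "(\<lambda>m. real m * ln (ln (real m))) \<in> O(\<lambda>m. real (max_letters 5 6 m))"
proof -
  obtain c where c: "\<And>m. c * slots 1 1 \<le> m \<Longrightarrow>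
    \<exists>n\<ge>1. m * n \<le> 4 * c * max_letters 5 6 m \<and> m < c * slots 1 (Suc n)"
    using max_letters_lower[of 1] by auto
  show ?thesis
  proof (rule bigoI[of _ "real ((2 + c) * (4 * c))"], rule eventually_mono[OF eventually_ge_at_top[of "16 + c * slots 1 1"]])
    \<comment> \<open>The 16 ensures that \<open>ln (real m)\<close> is at least 1. The factor
      \<open>2 + c\<close> comes from \<open>c + Suc n \<le> (2 + c) * n\<close>.\<close>
    fix m :: nat assume m: "16 + c * slots 1 1 \<le> m"
    then obtain n where n: "1 \<le> n" "m * n \<le> 4 * c * max_letters 5 6 m" "m < c * slots 1 (Suc n)"
      using c[of m] by auto
    have "c * slots 1 (Suc n) \<le> 2 ^ c * 2 ^ 2 ^ Suc n"
      using slots_1_le[of "Suc n"] less_exp[of c] by (intro mult_le_mono) auto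
    also have "\<dots> = 2 ^ (c + 2 ^ Suc n)" by (simp add: power_add)
    also have "\<dots> \<le> 2 ^ 2 ^ (c + Suc n)"
    proof (rule power_increasing)
      have "c * 1 \<le> c * 2 ^ Suc n" by (rule mult_le_mono2) simp
      then have "c + 2 ^ Suc n \<le> Suc c * 2 ^ Suc n" by simp
      also have "\<dots> \<le> 2 ^ c * 2 ^ Suc n" using Suc_le_power_2 by (rule mult_le_mono1)
      finally show "c + 2 ^ Suc n \<le> 2 ^ (c + Suc n)" by (simp add: power_add)
    qed simp
    finally have "m < 2 ^ 2 ^ (c + Suc n)" using n(3) by simp
    then have "real m < 2 ^ 2 ^ (c + Suc n)" by (metis of_nat_less_iff of_nat_numeral of_nat_power)
    moreover have "0 < real m" using m by simp
    ultimately have "ln (real m) \<le> ln (2 ^ 2 ^ (c + Suc n))" by (subst ln_le_cancel_iff) auto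
    also have "\<dots> = 2 ^ (c + Suc n) * ln 2" by (subst ln_realpow) auto
    also have "\<dots> \<le> 2 ^ (c + Suc n) * 1" using ln_2_less_1 by (intro mult_left_mono) auto
    finally have up: "ln (real m) \<le> 2 ^ (c + Suc n)" by simp
    have "exp 1 \<le> real m" using m exp_le by simp
    then have ge1: "1 \<le> ln (real m)" using \<open>0 < real m\<close> by (subst ln_ge_iff) auto
    have "ln (ln (real m)) \<le> ln (2 ^ (c + Suc n))" using up ge1 by (subst ln_le_cancel_iff) auto
    also have "\<dots> = real (c + Suc n) * ln 2" by (subst ln_realpow) auto
    also have "\<dots> \<le> real (c + Suc n) * 1" using ln_2_less_1 by (intro mult_left_mono) auto
    also have "\<dots> \<le> real ((2 + c) * n)"
    proof -
      have "c + Suc n \<le> (2 + c) * n" using n(1) by (cases n) (auto simp: algebra_simps)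
      then show ?thesis by (simp only: of_nat_le_iff mult_1_right)
    qed
    finally have "real m * ln (ln (real m)) \<le> real m * real ((2 + c) * n)" by (intro mult_left_mono) auto
    also have "\<dots> = real ((2 + c) * (m * n))" by (simp add: algebra_simps)
    also have "\<dots> \<le> real ((2 + c) * (4 * c * max_letters 5 6 m))"
      using n(2) by (simp only: of_nat_le_iff mult_le_mono2)
    also have "\<dots> = real ((2 + c) * (4 * c)) * real (max_letters 5 6 m)"
      by (simp only: of_nat_mult mult.assoc)
    finally show "norm (real m * ln (ln (real m))) \<le> real ((2 + c) * (4 * c)) * norm (real (max_letters 5 6 m))"
      using ge1 by (simp add: abs_mult)
  qed
qed

lemma max_letters_upper:
  assumes "2 \<le> d"
  shows "(\<lambda>m. real (max_letters 5 (2 * d + 2) m)) \<in> O(\<lambda>m. real m * real (inv_ack d m))"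
proof -
  obtain C where C: "cut_bound (2 * d + 2) (ack_hier d) C" using cut_bound_ack assms by blast
  show ?thesis
  proof (rule bigoI[of _ "real C"], rule always_eventually, rule allI)
    fix m
    have "cuttable (2 * d + 2) m (C * m * inv_ack d m)"
      using C ack_hier_inv_ack[OF assms] by (simp add: cut_bound_def)
    then have "max_letters 5 (2 * d + 2) m \<le> C * m * inv_ack d m" using assms by (intro max_letters_le) auto
    then have "real (max_letters 5 (2 * d + 2) m) \<le> real (C * m * inv_ack d m)" by (simp only: of_nat_le_iff)
    then show "norm (real (max_letters 5 (2 * d + 2) m)) \<le> real C * norm (real m * real (inv_ack d m))"
      by (simp add: mult.assoc)
  qed
qed

lemma max_letters_lower_inv_ack:
  assumes "3 \<le> d"
  shows "(\<lambda>m. real m * real (inv_ack d m)) \<in> O(\<lambda>m. real (max_letters 5 (2 * d + 2) m))"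
proof -
  obtain e where e: "d = Suc e" "2 \<le> e" using assms by (cases d) auto
  have d: "2 \<le> Suc e" using e by simp
  have k: "2 * d + 2 = 2 * e + 4" using e by simp
  obtain c where c: "\<And>m. c * slots e 1 \<le> m \<Longrightarrow>
    \<exists>n\<ge>1. m * n \<le> 4 * c * max_letters 5 (2 * d + 2) m \<and> m < c * slots e (Suc n)"
    using max_letters_lower[of e] e unfolding k by auto
  show ?thesis
  proof (rule bigoI[of _ "real ((6 + c) * (4 * c))"], rule eventually_mono[OF eventually_ge_at_top[of "c * slots e 1"]])
    fix m assume "c * slots e 1 \<le> m"
    then obtain n where n: "1 \<le> n" "m * n \<le> 4 * c * max_letters 5 (2 * d + 2) m" "m < c * slots e (Suc n)"
      using c[of m] by auto
    \<comment> \<open>The factor \<open>c\<close> turns into a shift by \<open>c\<close>; as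
      \<open>n\<close> is positive, \<open>3 * Suc n + c\<close> is at most
      \<open>(6 + c) * n\<close>.\<close>
    have "c * slots e (Suc n) \<le> 2 ^ c * ack_hier d (3 * Suc n)"
      unfolding e(1) by (intro mult_le_mono slots_le_ack_hier[OF e(2)] less_imp_le less_exp)
    also have "\<dots> \<le> ack_hier d (3 * Suc n + c)" unfolding e(1) by (rule ack_hier_add[OF d])
    finally have "m \<le> ack_hier d (3 * Suc n + c)" using n(3) by linarith
    then have "inv_ack d m \<le> 3 * Suc n + c" unfolding inv_ack_def by (rule Least_le)
    also have "\<dots> \<le> (6 + c) * n"
      using n(1) by (cases n) (auto simp: algebra_simps)
    finally have "m * inv_ack d m \<le> m * ((6 + c) * n)" by (rule mult_le_mono2)
    also have "\<dots> = (6 + c) * (m * n)" by (simp add: mult_ac)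
    also have "\<dots> \<le> (6 + c) * (4 * c * max_letters 5 (2 * d + 2) m)" using n(2) by (rule mult_le_mono2)
    finally have "real (m * inv_ack d m) \<le> real ((6 + c) * (4 * c) * max_letters 5 (2 * d + 2) m)"
      by (simp only: of_nat_le_iff mult.assoc)
    then show "norm (real m * real (inv_ack d m)) \<le> real ((6 + c) * (4 * c)) * norm (real (max_letters 5 (2 * d + 2) m))"
      by simp
  qed
qed

theorem mainTheorem2:
  "(\<lambda>m::nat. real (max_letters 5 6 m)) \<in> \<Theta>(\<lambda>m. real m * ln (ln (real m))) \<and>
   (\<forall>d::nat. d \<ge> 3 \<longrightarrow>
      (\<lambda>m::nat. real (max_letters 5 (2 * d + 2) m)) \<in> \<Theta>(\<lambda>m. real m * real (inv_ack d m)))"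
  using max_letters_6_upper max_letters_6_lower max_letters_upper max_letters_lower_inv_ack
  by (auto intro!: bigthetaI simp: bigomega_iff_bigo)

end
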